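(* Let $r\ge 1$ be an integer and let $V$ be a finite-dimensional complex vector space with $\dim V\ge 4r$. Then $$S_{(6,6,4^{4r-2})}V\subset I_{4r+1}(\sigma_r(Ch_4(V^* )));$$ that is, the $GL(V)$-module $I_{4r+1}(\sigma_r(Ch_4(V^* )))\subset S^{4r+1}(S^4V)$ contains an irreducible submodule isomorphic to $S_{(6,6,4^{4r-2})}V$.
   Context: For a finite-dimensional complex vector space $U$, the Chow variety is $Ch_d(U)=\mathbb{P}\{z\in S^dU \mid z=w_1\cdots w_d \text{ for some } w_i\in U\}\subset \mathbb{P}S^dU$. For a projective variety $X\subset\mathbb{P}W^*$, the $r$-th secant variety $\sigma_r(X)\subset\mathbb{P}W^*$ is the Zariski closure of $\bigcup_{p_1,\dots,p_r\in X}\langle p_1,\dots,p_r\rangle$, where $\langle p_1,\dots,p_r\rangle$ is the projective linear span. $I_\delta(X)\subset S^\delta W$ denotes the space of homogeneous degree-$\delta$ polynomials on $W^*$ vanishing on $X$; with $W=S^dV$ and $X=\sigma_r(Ch_d(V^* ))$ it is a $GL(V)$-submodule of $S^\delta(S^dV)$. For a partition $\lambda$, $S_\lambda V$ is the irreducible polynomial $GL(V)$-module of highest weight $\lambda$. The exponent notation means repetition: $(6,6,4^{4r-2})$ is the partition with two parts equal to $6$ followed by $4r-2$ parts equal to $4$. *)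

theory Defs
  imports Complex_Main "HOL-Library.Function_Algebras"
begin

text \<open>
  A complex vector space is given by its scalar multiplication \<open>s\<close>; the vector space \<open>V\<close> is the
  whole type \<open>'v\<close>. Symmetric powers are realised as spaces of homogeneous polynomial functions on
  the dual space, with the pointwise vector space structure:
  \<open>S\<^sup>d V\<^sup>*\<close> consists of functions on \<open>V\<close>, and, writing \<open>W\<^sup>* = S\<^sup>d V\<^sup>*\<close>, the space
  \<open>S\<^sup>\<delta> W = S\<^sup>\<delta> (S\<^sup>d V)\<close> consists of functions on \<open>W\<^sup>*\<close>.
\<close>

definition fun_scale :: "(complex \<Rightarrow> 'b \<Rightarrow> 'b) \<Rightarrow> complex \<Rightarrow> ('a \<Rightarrow> 'b) \<Rightarrow> 'a \<Rightarrow> 'b" where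
  "fun_scale s c f = (\<lambda>x. s c (f x))"

abbreviation cfun_scale :: "complex \<Rightarrow> ('a \<Rightarrow> complex) \<Rightarrow> 'a \<Rightarrow> complex" where
  "cfun_scale \<equiv> fun_scale (*)"

text \<open>
  Homogeneous polynomial functions of degree \<open>d\<close> on a subspace \<open>A\<close>: linear combinations of products
  of \<open>d\<close> linear forms on \<open>A\<close>. Every linear form on \<open>A\<close> is the restriction of one on the ambient
  space. The functions are set to \<open>0\<close> outside \<open>A\<close>, so that equality is equality on \<open>A\<close>.
\<close>

definition hom_polys ::
  "(complex \<Rightarrow> 'a::ab_group_add \<Rightarrow> 'a) \<Rightarrow> 'a set \<Rightarrow> nat \<Rightarrow> ('a \<Rightarrow> complex) set" where
  "hom_polys s A d = module.span cfun_scale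
     {(\<lambda>x. if x \<in> A then \<Prod>i<d. l i x else 0) | l. \<forall>i<d. Vector_Spaces.linear s (*) (l i)}"

abbreviation sym_dual ::
  "(complex \<Rightarrow> 'v::ab_group_add \<Rightarrow> 'v) \<Rightarrow> nat \<Rightarrow> ('v \<Rightarrow> complex) set" where
  "sym_dual s d \<equiv> hom_polys s UNIV d"

text \<open>Points of a projective space are one-dimensional linear subspaces.\<close>

definition proj :: "(complex \<Rightarrow> 'a::ab_group_add \<Rightarrow> 'a) \<Rightarrow> 'a set \<Rightarrow> 'a set set" where
  "proj s A = {module.span s {z} | z. z \<in> A \<and> z \<noteq> 0}"

definition vanishes_on :: "('a \<Rightarrow> complex) \<Rightarrow> 'a set set \<Rightarrow> bool" where
  "vanishes_on F X \<longleftrightarrow> (\<forall>p\<in>X. \<forall>z\<in>p. F z = 0)"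

definition zariski_closed ::
  "(complex \<Rightarrow> 'a::ab_group_add \<Rightarrow> 'a) \<Rightarrow> 'a set \<Rightarrow> 'a set set \<Rightarrow> bool" where
  "zariski_closed s A Z \<longleftrightarrow>
     (\<exists>E \<subseteq> (\<Union>d. hom_polys s A d). Z = {p \<in> proj s A. \<forall>F\<in>E. vanishes_on F {p}})"

definition chow_dual ::
  "(complex \<Rightarrow> 'v::ab_group_add \<Rightarrow> 'v) \<Rightarrow> nat \<Rightarrow> ('v \<Rightarrow> complex) set set" where
  "chow_dual s d = proj cfun_scale
     {z \<in> sym_dual s d. \<exists>w. (\<forall>i<d. Vector_Spaces.linear s (*) (w i)) \<and> z = (\<lambda>v. \<Prod>i<d. w i v)}"

definition secant_variety ::
  "(complex \<Rightarrow> 'a::ab_group_add \<Rightarrow> 'a) \<Rightarrow> 'a set \<Rightarrow> nat \<Rightarrow> 'a set set \<Rightarrow> 'a set set" where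
  "secant_variety s A r X =
     zariski_closed s A hull
       (\<Union>p \<in> {p. \<forall>i<r. p i \<in> X}. proj s (module.span s (\<Union>i<r. p i)))"

definition ideal_part ::
  "(complex \<Rightarrow> 'a::ab_group_add \<Rightarrow> 'a) \<Rightarrow> 'a set \<Rightarrow> nat \<Rightarrow> 'a set set \<Rightarrow> ('a \<Rightarrow> complex) set" where
  "ideal_part s A \<delta> X = {F \<in> hom_polys s A \<delta>. vanishes_on F X}"

definition GL :: "(complex \<Rightarrow> 'v::ab_group_add \<Rightarrow> 'v) \<Rightarrow> ('v \<Rightarrow> 'v) set" where
  "GL s = {g. Vector_Spaces.linear s s g \<and> bij g}"

text \<open>
  If \<open>g\<close> acts on \<open>X\<close>, it acts on functions on \<open>X\<close> by \<open>f \<mapsto> f \<circ> g\<inverse>\<close>. Applied once to \<open>g \<in> GL(V)\<close> this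
  is the action on \<open>S\<^sup>d V\<^sup>*\<close>, applied twice it is the action on \<open>S\<^sup>\<delta> (S\<^sup>d V)\<close>.
\<close>

definition fun_act :: "('a \<Rightarrow> 'a) \<Rightarrow> ('a \<Rightarrow> 'b) \<Rightarrow> 'a \<Rightarrow> 'b" where
  "fun_act g f = f \<circ> inv g"

text \<open>
  In the following, \<open>\<rho>\<close> is an action of \<open>GL(V)\<close> on a subspace \<open>M\<close> of a vector space with scalar
  multiplication \<open>t\<close>.
\<close>

definition is_GL_module ::
  "(complex \<Rightarrow> 'v::ab_group_add \<Rightarrow> 'v) \<Rightarrow> (complex \<Rightarrow> 'w::ab_group_add \<Rightarrow> 'w) \<Rightarrow>
   (('v \<Rightarrow> 'v) \<Rightarrow> 'w \<Rightarrow> 'w) \<Rightarrow> 'w set \<Rightarrow> bool" where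
  "is_GL_module s t \<rho> M \<longleftrightarrow>
     module.subspace t M \<and>
     (\<forall>g\<in>GL s. \<forall>x\<in>M. \<rho> g x \<in> M) \<and>
     (\<forall>g\<in>GL s. \<forall>x\<in>M. \<forall>y\<in>M. \<rho> g (x + y) = \<rho> g x + \<rho> g y) \<and>
     (\<forall>g\<in>GL s. \<forall>c. \<forall>x\<in>M. \<rho> g (t c x) = t c (\<rho> g x)) \<and>
     (\<forall>x\<in>M. \<rho> id x = x) \<and>
     (\<forall>g\<in>GL s. \<forall>h\<in>GL s. \<forall>x\<in>M. \<rho> (g \<circ> h) x = \<rho> g (\<rho> h x))"

definition irreducible_GL_module ::
  "(complex \<Rightarrow> 'v::ab_group_add \<Rightarrow> 'v) \<Rightarrow> (complex \<Rightarrow> 'w::ab_group_add \<Rightarrow> 'w) \<Rightarrow>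
   (('v \<Rightarrow> 'v) \<Rightarrow> 'w \<Rightarrow> 'w) \<Rightarrow> 'w set \<Rightarrow> bool" where
  "irreducible_GL_module s t \<rho> M \<longleftrightarrow>
     is_GL_module s t \<rho> M \<and> M \<noteq> {0} \<and>
     (\<forall>N. N \<subseteq> M \<and> is_GL_module s t \<rho> N \<longrightarrow> N = {0} \<or> N = M)"

text \<open>
  Polynomial: every matrix coefficient is the restriction to \<open>GL(V)\<close> of a (not necessarily
  homogeneous) polynomial function on \<open>End(V)\<close>.
\<close>

definition polynomial_GL_module ::
  "(complex \<Rightarrow> 'v::ab_group_add \<Rightarrow> 'v) \<Rightarrow> (complex \<Rightarrow> 'w::ab_group_add \<Rightarrow> 'w) \<Rightarrow>
   (('v \<Rightarrow> 'v) \<Rightarrow> 'w \<Rightarrow> 'w) \<Rightarrow> 'w set \<Rightarrow> bool" where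
  "polynomial_GL_module s t \<rho> M \<longleftrightarrow>
     is_GL_module s t \<rho> M \<and>
     (\<forall>\<phi> m. Vector_Spaces.linear t (*) \<phi> \<and> m \<in> M \<longrightarrow>
       (\<exists>F \<in> module.span cfun_scale
              (\<Union>d. hom_polys (fun_scale s) {h. Vector_Spaces.linear s s h} d).
          \<forall>g\<in>GL s. \<phi> (\<rho> g m) = F g))"

definition ordered_basis ::
  "(complex \<Rightarrow> 'v::ab_group_add \<Rightarrow> 'v) \<Rightarrow> 'v list \<Rightarrow> bool" where
  "ordered_basis s bs \<longleftrightarrow>
     distinct bs \<and> \<not> module.dependent s (set bs) \<and> module.span s (set bs) = UNIV"

text \<open>
  The elements of \<open>GL(V)\<close> that are upper triangular with diagonal entries \<open>a 0, a 1, \<dots>\<close> in the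
  basis \<open>bs\<close>.
\<close>

definition borel_elems ::
  "(complex \<Rightarrow> 'v::ab_group_add \<Rightarrow> 'v) \<Rightarrow> 'v list \<Rightarrow> (nat \<Rightarrow> complex) \<Rightarrow> ('v \<Rightarrow> 'v) set" where
  "borel_elems s bs a =
     {g \<in> GL s. \<forall>j<length bs. g (bs ! j) - s (a j) (bs ! j) \<in> module.span s (set (take j bs))}"

text \<open>
  A nonzero vector on which the Borel subgroup acts through the character of \<open>\<mu>\<close>; equivalently,
  it is fixed by the unipotent upper triangular elements and is a weight vector of weight \<open>\<mu>\<close> for
  the diagonal torus. Trailing zeros of \<open>\<mu>\<close> are omitted.
\<close>

definition highest_weight_vector ::
  "(complex \<Rightarrow> 'v::ab_group_add \<Rightarrow> 'v) \<Rightarrow> (complex \<Rightarrow> 'w::ab_group_add \<Rightarrow> 'w) \<Rightarrow>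
   (('v \<Rightarrow> 'v) \<Rightarrow> 'w \<Rightarrow> 'w) \<Rightarrow> 'v list \<Rightarrow> nat list \<Rightarrow> 'w \<Rightarrow> bool" where
  "highest_weight_vector s t \<rho> bs \<mu> m \<longleftrightarrow>
     m \<noteq> 0 \<and>
     (\<forall>a. \<forall>g \<in> borel_elems s bs a. \<rho> g m = t (\<Prod>i<length \<mu>. a i ^ (\<mu> ! i)) m)"

text \<open>
  \<open>M\<close> is (a copy of) \<open>S\<^sub>\<mu> V\<close>, the irreducible polynomial module of highest weight \<open>\<mu>\<close>. All ordered
  bases of \<open>V\<close> are conjugate under \<open>GL(V)\<close>, so the choice of \<open>bs\<close> is immaterial.
\<close>

definition is_schur_module ::
  "(complex \<Rightarrow> 'v::ab_group_add \<Rightarrow> 'v) \<Rightarrow> (complex \<Rightarrow> 'w::ab_group_add \<Rightarrow> 'w) \<Rightarrow>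
   (('v \<Rightarrow> 'v) \<Rightarrow> 'w \<Rightarrow> 'w) \<Rightarrow> nat list \<Rightarrow> 'w set \<Rightarrow> bool" where
  "is_schur_module s t \<rho> \<mu> M \<longleftrightarrow>
     sorted_wrt (\<ge>) \<mu> \<and>
     irreducible_GL_module s t \<rho> M \<and>
     polynomial_GL_module s t \<rho> M \<and>
     (\<exists>bs. ordered_basis s bs \<and> length \<mu> \<le> length bs \<and>
        (\<exists>m\<in>M. highest_weight_vector s t \<rho> bs \<mu> m))"

end

theory Submission
  imports Defs "HOL-Combinatorics.Permutations" "HOL-Library.FuncSet"
begin

text \<open>
  Put \<open>n = 4 r\<close>. A highest weight vector of weight \<open>(6, 6, 4\<^sup>n\<^sup>-\<^sup>2)\<close> in
  \<open>S\<^sup>n\<^sup>+\<^sup>1(S\<^sup>4 V)\<close> has the symbolic form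
  \<open>[x y\<^sub>1 \<dots> y\<^sub>n\<^sub>-\<^sub>1]\<^sup>2 [x' y\<^sub>1 \<dots> y\<^sub>n\<^sub>-\<^sub>1]\<^sup>2 [x x']\<^sup>2\<close>, with brackets in the first \<open>n\<close>
  (respectively two) basis vectors. On a sum of fourth powers of real linear forms it is a sum of
  squares, so it is not zero.

  On a sum \<open>f\<close> of \<open>r\<close> products of four linear forms the factor \<open>[x x']\<^sup>2\<close> is contracted with a
  tensor \<open>T\<close> in \<open>S\<^sup>2 \<otimes> S\<^sup>2\<close> that is equivariant in \<open>f\<close>. If the \<open>4 r\<close> forms are linearly dependent,
  \<open>T = 0\<close>. Otherwise \<open>f\<close> is fixed by the torus of diagonal matrices whose entries multiply to 1 on
  every block of four coordinates, which leaves in \<open>T\<close> only products of the four forms of one block,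
  and by the transpositions inside a block, which make \<open>T\<close> symmetric. Hence its contraction with the
  antisymmetric \<open>[x x']\<close> vanishes.

  For irreducibility no Weyl theory is needed: the module generated by the highest weight vector is
  completely reducible, and the projection of the vector to an irreducible submodule along an
  invariant complement is nonzero and again a highest weight vector of the same weight.
\<close>

section \<open>Alternating multilinear functions\<close>

locale complex_vector_space = vector_space scale
  for scale :: "complex \<Rightarrow> 'v::ab_group_add \<Rightarrow> 'v" (infixr "*s" 75)
begin

text \<open>\<open>Vector_Spaces.linear\<close> also asserts the vector space axioms on both sides;
  here only the two equations remain, and \<open>linear_iff_lin\<close> translates.\<close>

definition lin :: "('v \<Rightarrow> complex) \<Rightarrow> bool" where
  "lin \<phi> \<longleftrightarrow> (\<forall>x y. \<phi> (x + y) = \<phi> x + \<phi> y) \<and> (\<forall>c x. \<phi> (c *s x) = c * \<phi> x)"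

lemma vector_space_complex: "vector_space ((*) :: complex \<Rightarrow> complex \<Rightarrow> complex)"
  by unfold_locales (auto simp: algebra_simps)

lemma linear_iff_lin: "Vector_Spaces.linear (*s) (*) \<phi> \<longleftrightarrow> lin \<phi>"
  using vector_space_axioms vector_space_complex by (simp add: Vector_Spaces.linear_iff lin_def)

lemma lin_add: "lin \<phi> \<Longrightarrow> \<phi> (x + y) = \<phi> x + \<phi> y"
  and lin_scale: "lin \<phi> \<Longrightarrow> \<phi> (c *s x) = c * \<phi> x"
  by (auto simp: lin_def)

lemma lin_zero: "lin \<phi> \<Longrightarrow> \<phi> 0 = 0"
  using lin_scale[of \<phi> 0 0] by simp

lemma lin_minus: "lin \<phi> \<Longrightarrow> \<phi> (x - y) = \<phi> x - \<phi> y"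
  using lin_add[of \<phi> "x - y" y] by simp

lemma lin_sum: "lin \<phi> \<Longrightarrow> \<phi> (\<Sum>i\<in>I. x i) = (\<Sum>i\<in>I. \<phi> (x i))"
  by (induction I rule: infinite_finite_induct) (auto simp: lin_zero lin_add)

lemma lin_const_0 [simp]: "lin (\<lambda>_. 0)"
  by (simp add: lin_def)

lemma lin_plus: "lin \<phi> \<Longrightarrow> lin \<psi> \<Longrightarrow> lin (\<lambda>x. \<phi> x + \<psi> x)"
  and lin_diff: "lin \<phi> \<Longrightarrow> lin \<psi> \<Longrightarrow> lin (\<lambda>x. \<phi> x - \<psi> x)"
  and lin_cmult: "lin \<phi> \<Longrightarrow> lin (\<lambda>x. c * \<phi> x)"
  and lin_multc: "lin \<phi> \<Longrightarrow> lin (\<lambda>x. \<phi> x * c)"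
  by (auto simp: lin_def algebra_simps)

lemma lin_sum_fun: "(\<And>i. i \<in> I \<Longrightarrow> lin (\<phi> i)) \<Longrightarrow> lin (\<lambda>x. \<Sum>i\<in>I. \<phi> i x)"
  by (induction I rule: infinite_finite_induct) (auto simp: lin_plus)

lemma lin_eq_0_on_span:
  assumes "lin \<phi>" "\<And>x. x \<in> S \<Longrightarrow> \<phi> x = 0" "x \<in> span S"
  shows "\<phi> x = 0"
  using assms(3) by (induction rule: span_induct_alt) (auto simp: assms lin_zero lin_add lin_scale)

text \<open>Tuples are total functions on \<open>nat\<close>. The second clause says that only the
  first \<open>n\<close> entries matter, so the tail of a tuple such as \<open>(!) bs\<close> is
  harmless.\<close>

definition multilin :: "nat \<Rightarrow> ((nat \<Rightarrow> 'v) \<Rightarrow> complex) \<Rightarrow> bool" where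
  "multilin n T \<longleftrightarrow>
     (\<forall>p. \<forall>i<n. lin (\<lambda>x. T (p(i := x)))) \<and> (\<forall>p q. (\<forall>i<n. p i = q i) \<longrightarrow> T p = T q)"

definition alternating :: "nat \<Rightarrow> ((nat \<Rightarrow> 'v) \<Rightarrow> complex) \<Rightarrow> bool" where
  "alternating n A \<longleftrightarrow> multilin n A \<and> (\<forall>p. \<forall>i<n. \<forall>j<n. i \<noteq> j \<longrightarrow> p i = p j \<longrightarrow> A p = 0)"

text \<open>Antisymmetrization without the factor 1/n!. Applied to a product of linear forms it is
  their determinant on \<open>b\<close>, so each bracket of the symbolic form becomes one
  \<open>alt\<close>.\<close>

definition alt :: "nat \<Rightarrow> ((nat \<Rightarrow> 'v) \<Rightarrow> complex) \<Rightarrow> (nat \<Rightarrow> 'v) \<Rightarrow> complex" where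
  "alt n T b = (\<Sum>\<sigma> | \<sigma> permutes {..<n}. of_int (sign \<sigma>) * T (b \<circ> \<sigma>))"

lemma multilin_lin: "multilin n T \<Longrightarrow> i < n \<Longrightarrow> lin (\<lambda>x. T (p(i := x)))"
  by (simp add: multilin_def)

lemma multilin_cong: "multilin n T \<Longrightarrow> (\<And>i. i < n \<Longrightarrow> p i = q i) \<Longrightarrow> T p = T q"
  by (simp add: multilin_def)

lemma alternating_multilin: "alternating n A \<Longrightarrow> multilin n A"
  by (simp add: alternating_def)

lemma alternating_eq_0: "alternating n A \<Longrightarrow> i < n \<Longrightarrow> j < n \<Longrightarrow> i \<noteq> j \<Longrightarrow> p i = p j \<Longrightarrow> A p = 0"
  by (auto simp: alternating_def)

lemma multilin_prod:
  assumes "\<And>i. i < n \<Longrightarrow> lin (\<phi> i)"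
  shows "multilin n (\<lambda>p. \<Prod>i<n. \<phi> i (p i))"
  unfolding multilin_def
proof (intro conjI allI impI)
  fix p :: "nat \<Rightarrow> 'v" and k assume k: "k < n"
  have "(\<Prod>i<n. \<phi> i ((p(k := x)) i)) = \<phi> k x * (\<Prod>i\<in>{..<n} - {k}. \<phi> i (p i))" for x
    using k by (subst prod.remove[of _ k]) (auto intro!: prod.cong)
  then show "lin (\<lambda>x. \<Prod>i<n. \<phi> i ((p(k := x)) i))"
    using assms[OF k] by (simp add: lin_multc)
qed auto

lemma multilin_sum: "(\<And>i. i \<in> I \<Longrightarrow> multilin n (T i)) \<Longrightarrow> multilin n (\<lambda>p. \<Sum>i\<in>I. T i p)"
  unfolding multilin_def by (auto intro!: lin_sum_fun sum.cong)

lemma multilin_cmult: "multilin n T \<Longrightarrow> multilin n (\<lambda>p. c * T p)"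
  unfolding multilin_def by (simp add: lin_cmult)

lemma multilin_diff: "multilin n T \<Longrightarrow> multilin n S \<Longrightarrow> multilin n (\<lambda>p. T p - S p)"
  unfolding multilin_def by (simp add: lin_diff) metis

lemma alternating_sum: "(\<And>i. i \<in> I \<Longrightarrow> alternating n (A i)) \<Longrightarrow> alternating n (\<lambda>p. \<Sum>i\<in>I. A i p)"
  unfolding alternating_def by (auto intro!: multilin_sum sum.neutral)

lemma alternating_cmult: "alternating n A \<Longrightarrow> alternating n (\<lambda>p. c * A p)"
  by (auto simp: alternating_def multilin_cmult)

lemma alternating_diff: "alternating n A \<Longrightarrow> alternating n B \<Longrightarrow> alternating n (\<lambda>p. A p - B p)"
  by (auto simp: alternating_def multilin_diff)

lemma alternating_alt_fun: "(\<And>q. alternating n (\<lambda>p. T p q)) \<Longrightarrow> alternating n (\<lambda>p. alt k (T p) b)"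
  unfolding alt_def by (intro alternating_sum alternating_cmult)

lemma multilin_alt_fun: "(\<And>q. multilin n (\<lambda>p. T p q)) \<Longrightarrow> multilin n (\<lambda>p. alt k (T p) b)"
  unfolding alt_def by (intro multilin_sum multilin_cmult)

lemma lin_alt_fun: "(\<And>q. lin (\<lambda>x. T x q)) \<Longrightarrow> lin (\<lambda>x. alt k (T x) b)"
  unfolding alt_def by (intro lin_sum_fun lin_cmult)

text \<open>If two entries agree, composing with their transposition leaves the tuple fixed and
  reverses every sign, so the sum equals its own negative.\<close>

lemma alternating_alt:
  assumes "multilin n T"
  shows "alternating n (alt n T)"
  unfolding alternating_def
proof (intro conjI allI impI)
  show "multilin n (alt n T)"
    unfolding multilin_def alt_def
  proof (intro conjI allI impI lin_sum_fun lin_cmult)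
    fix p :: "nat \<Rightarrow> 'v" and i \<sigma> assume i: "i < n" and "\<sigma> \<in> {\<sigma>. \<sigma> permutes {..<n}}"
    then have s: "\<sigma> permutes {..<n}" by simp
    have "p(i := x) \<circ> \<sigma> = (p \<circ> \<sigma>)(inv \<sigma> i := x)" for x
      using permutes_inverses[OF s] by (fastforce simp: fun_eq_iff)
    moreover have "inv \<sigma> i < n"
      using permutes_in_image[OF permutes_inv[OF s]] i by blast
    ultimately show "lin (\<lambda>x. T (p(i := x) \<circ> \<sigma>))"
      using multilin_lin[OF assms] by simp
  next
    fix p q :: "nat \<Rightarrow> 'v" assume pq: "\<forall>i<n. p i = q i"
    have "T (p \<circ> \<sigma>) = T (q \<circ> \<sigma>)" if "\<sigma> permutes {..<n}" for \<sigma>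
      using pq permutes_in_image[OF that] by (intro multilin_cong[OF assms]) auto
    then show "(\<Sum>\<sigma> | \<sigma> permutes {..<n}. of_int (sign \<sigma>) * T (p \<circ> \<sigma>)) =
      (\<Sum>\<sigma> | \<sigma> permutes {..<n}. of_int (sign \<sigma>) * T (q \<circ> \<sigma>))" by simp
  qed
next
  fix p :: "nat \<Rightarrow> 'v" and i j assume ij: "i < n" "j < n" "i \<noteq> j" "p i = p j"
  let ?t = "Transposition.transpose i j"
  have t: "?t permutes {..<n}" using ij by (intro permutes_swap_id) auto
  have pt: "p \<circ> ?t = p" using ij by (auto simp: fun_eq_iff transpose_def)
  have "alt n T p = (\<Sum>\<sigma> | \<sigma> permutes {..<n}. of_int (sign (?t \<circ> \<sigma>)) * T (p \<circ> (?t \<circ> \<sigma>)))"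
    unfolding alt_def by (rule setum_permutations_compose_left[OF t])
  also have "\<dots> = (\<Sum>\<sigma> | \<sigma> permutes {..<n}. - (of_int (sign \<sigma>) * T (p \<circ> \<sigma>)))"
  proof (rule sum.cong[OF refl])
    fix \<sigma> assume "\<sigma> \<in> {\<sigma>. \<sigma> permutes {..<n}}"
    then have "permutation \<sigma>" using permutation_permutes by blast
    then have "sign (?t \<circ> \<sigma>) = - sign \<sigma>"
      using ij(3) by (simp add: sign_compose permutation_swap_id sign_swap_id)
    then show "of_int (sign (?t \<circ> \<sigma>)) * T (p \<circ> (?t \<circ> \<sigma>)) = - (of_int (sign \<sigma>) * T (p \<circ> \<sigma>))"
      using pt by (simp add: comp_assoc[symmetric])
  qed
  also have "\<dots> = - alt n T p" by (simp add: alt_def sum_negf)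
  finally show "alt n T p = 0" by simp
qed

text \<open>Put \<open>x + y\<close> into both positions and expand: the terms with a repeated entry
  vanish, so the two mixed terms cancel.\<close>

lemma alternating_swap:
  assumes A: "alternating n A" and ij: "i < n" "j < n" "i \<noteq> j"
  shows "A (p \<circ> Transposition.transpose i j) = - A p"
proof -
  let ?f = "\<lambda>x y. A (p(i := x, j := y))"
  have li: "lin (\<lambda>x. ?f x y)" for y
    using multilin_lin[OF alternating_multilin[OF A] ij(1), of "p(j := y)"] ij(3)
    by (simp add: fun_upd_twist)
  have lj: "lin (\<lambda>y. ?f x y)" for x
    using multilin_lin[OF alternating_multilin[OF A] ij(2), of "p(i := x)"] by simp
  have z: "?f x x = 0" for x
    using alternating_eq_0[OF A ij] ij(3) by simp
  have "?f x y + ?f y x = 0" for x y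
    using z[of "x + y"] z[of x] z[of y] by (simp add: lin_add[OF li] lin_add[OF lj] add.commute)
  from this[of "p i" "p j"] have "A p + A (p(i := p j, j := p i)) = 0"
    by simp
  moreover have "p(i := p j, j := p i) = p \<circ> Transposition.transpose i j"
    using ij(3) by (auto simp: fun_eq_iff transpose_def)
  ultimately show ?thesis by (metis add_eq_0_iff)
qed

lemma alternating_replace:
  assumes A: "alternating n A" and k: "k < n"
    and y: "y - a *s p k \<in> span (p ` ({..<n} - {k}))"
  shows "A (p(k := y)) = a * A p"
proof -
  have l: "lin (\<lambda>x. A (p(k := x)))"
    using multilin_lin[OF alternating_multilin[OF A] k] .
  have "A (p(k := y - a *s p k)) = 0"
  proof (rule lin_eq_0_on_span[OF l _ y])
    fix x assume "x \<in> p ` ({..<n} - {k})"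
    then obtain j where "j < n" "j \<noteq> k" "x = p j" by auto
    then show "A (p(k := x)) = 0" by (intro alternating_eq_0[OF A k]) auto
  qed
  then show ?thesis
    using lin_minus[OF l] lin_scale[OF l] by simp
qed

text \<open>This is how a Borel element acts through a character: an alternating function of
  \<open>n\<close> vectors sees only the determinant of the leading block.\<close>

lemma alternating_triangular:
  assumes A: "alternating n A" and n: "n \<le> length bs"
    and g: "\<And>j. j < length bs \<Longrightarrow> g (bs ! j) - a j *s (bs ! j) \<in> span (set (take j bs))"
  shows "A (g \<circ> (!) bs) = (\<Prod>i<n. a i) * A ((!) bs)"
proof -
  \<comment> \<open>\<open>?p k\<close> has been returned to the basis below \<open>k\<close>.
    Passing from \<open>k\<close> to \<open>Suc k\<close> restores entry \<open>k\<close>, whose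
    correction term lies in the span of the entries restored before.\<close>
  let ?p = "\<lambda>k j. if k \<le> j then g (bs ! j) else bs ! j"
  have "A (?p 0) = (\<Prod>i<k. a i) * A (?p k)" if "k \<le> n" for k
    using that
  proof (induction k)
    case (Suc k)
    have "?p k = (?p (Suc k))(k := g (bs ! k))" by (auto simp: fun_eq_iff)
    moreover have "set (take k bs) \<subseteq> ?p (Suc k) ` ({..<n} - {k})"
    proof
      fix x assume "x \<in> set (take k bs)"
      then obtain j where "j < k" "x = bs ! j"
        by (auto simp: in_set_conv_nth)
      then show "x \<in> ?p (Suc k) ` ({..<n} - {k})"
        using Suc.prems by (intro image_eqI[of _ _ j]) auto
    qed
    then have "g (bs ! k) - a k *s ?p (Suc k) k \<in> span (?p (Suc k) ` ({..<n} - {k}))"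
      using g[of k] Suc.prems n span_mono[of "set (take k bs)"] by auto
    then have "A ((?p (Suc k))(k := g (bs ! k))) = a k * A (?p (Suc k))"
      using Suc.prems by (intro alternating_replace[OF A]) auto
    ultimately show ?case using Suc by simp
  qed simp
  from this[of n] have "A (?p 0) = (\<Prod>i<n. a i) * A (?p n)" by simp
  also have "?p 0 = g \<circ> (!) bs" by auto
  also have "A (?p n) = A ((!) bs)"
    by (rule multilin_cong[OF alternating_multilin[OF A]]) simp
  finally show ?thesis .
qed

text \<open>The exterior power of degree \<open>n\<close> of a space spanned by \<open>n\<close>
  vectors is at most one-dimensional, so \<open>A\<close> is determined there by its value on
  \<open>u\<close>. The proof widens the class of tuples: permutations of \<open>u\<close>, tuples
  of entries of \<open>u\<close>, tuples in the span.\<close>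

lemma alternating_eq_0_on_span:
  assumes A: "alternating n A" and u: "A u = 0"
    and b: "\<And>j. j < n \<Longrightarrow> b j \<in> span (u ` {..<n})"
  shows "A b = 0"
proof -
  have perm: "A (u \<circ> \<sigma>) = 0" if "\<sigma> permutes {..<n}" for \<sigma>
    using finite_lessThan that
  proof (induction rule: permutes_rev_induct)
    case (swap i j \<sigma>)
    show ?case
    proof (cases "i = j")
      case False
      then have "A ((u \<circ> \<sigma>) \<circ> Transposition.transpose i j) = - A (u \<circ> \<sigma>)"
        using swap by (intro alternating_swap[OF A]) auto
      then show ?thesis using swap by (simp only: comp_assoc minus_zero)
    qed (use swap in simp)
  qed (use u in simp)
  have base: "A p = 0" if "\<forall>j<n. p j \<in> u ` {..<n}" for p
  proof -
    have "\<forall>j. \<exists>i. j < n \<longrightarrow> i < n \<and> p j = u i"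
      using that by (auto simp: image_iff)
    then obtain \<phi> where \<phi>: "\<And>j. j < n \<Longrightarrow> \<phi> j < n \<and> p j = u (\<phi> j)"
      by metis
    show ?thesis
    proof (cases "inj_on \<phi> {..<n}")
      case False
      then obtain i j where "i < n" "j < n" "i \<noteq> j" "\<phi> i = \<phi> j" by (auto simp: inj_on_def)
      then show ?thesis using \<phi> by (intro alternating_eq_0[OF A, of i j]) auto
    next
      case True
      let ?s = "\<lambda>j. if j < n then \<phi> j else j"
      have "inj_on ?s {..<n}" using True by (auto simp: inj_on_def)
      moreover have "?s ` {..<n} \<subseteq> {..<n}" using \<phi> by auto
      ultimately have "bij_betw ?s {..<n} {..<n}"
        by (simp only: bij_betw_def endo_inj_surj[OF finite_lessThan])
      then have "?s permutes {..<n}"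
        by (rule bij_imp_permutes) simp
      then have "A (u \<circ> ?s) = 0" by (rule perm)
      moreover have "A p = A (u \<circ> ?s)"
        using \<phi> by (intro multilin_cong[OF alternating_multilin[OF A]]) auto
      ultimately show ?thesis by simp
    qed
  qed
  \<comment> \<open>\<open>k\<close> counts the leading entries that may be arbitrary vectors of the
    span; the remaining ones are still among the \<open>u i\<close>.\<close>
  have "A p = 0" if "k \<le> n" "\<forall>j<k. p j \<in> span (u ` {..<n})" "\<forall>j. k \<le> j \<longrightarrow> j < n \<longrightarrow> p j \<in> u ` {..<n}" for k p
    using that
  proof (induction k arbitrary: p)
    case 0
    then show ?case by (intro base) auto
  next
    case (Suc k)
    then have k: "k < n" by simp
    have "A (p(k := x)) = 0" if "x \<in> u ` {..<n}" for x
      using Suc.prems that by (intro Suc.IH) (auto simp: less_Suc_eq)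
    moreover have "p k \<in> span (u ` {..<n})" using Suc.prems by simp
    ultimately have "A (p(k := p k)) = 0"
      by (rule lin_eq_0_on_span[OF multilin_lin[OF alternating_multilin[OF A] k]])
    then show ?case by simp
  qed
  from this[of n b] show ?thesis using b by auto
qed

end

section \<open>Polarization and the bracket form\<close>

lemma fun_scale_apply: "fun_scale s c f x = s c (f x)"
  by (simp add: fun_scale_def)

interpretation cfun: vector_space "cfun_scale :: complex \<Rightarrow> ('a \<Rightarrow> complex) \<Rightarrow> 'a \<Rightarrow> complex"
  by unfold_locales (auto simp: fun_scale_def fun_eq_iff algebra_simps)

lemma sum_fun_apply: "(\<Sum>i\<in>I. f i) x = (\<Sum>i\<in>I. f i x)"
  for f :: "'i \<Rightarrow> 'a \<Rightarrow> 'b::comm_monoid_add"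
  by (induction I rule: infinite_finite_induct) auto

text \<open>The polarization of a quartic form by inclusion and exclusion. In this shape it is a linear form
  in \<open>f\<close> on the space of all functions, as the definition of \<^const>\<open>hom_polys\<close> requires.\<close>

definition pol :: "('v::ab_group_add \<Rightarrow> complex) \<Rightarrow> 'v \<Rightarrow> 'v \<Rightarrow> 'v \<Rightarrow> 'v \<Rightarrow> complex" where
  "pol f a b c d = f (a+b+c+d) - f (a+b+c) - f (a+b+d) - f (a+c+d) - f (b+c+d)
     + f (a+b) + f (a+c) + f (a+d) + f (b+c) + f (b+d) + f (c+d) - f a - f b - f c - f d"

lemma pol_plus: "pol (f + g) a b c d = pol f a b c d + pol g a b c d"
  and pol_scale: "pol (cfun_scale k f) a b c d = k * pol f a b c d"
  by (simp_all add: pol_def fun_scale_def algebra_simps)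

lemma pol_sum: "pol (\<lambda>v. \<Sum>i\<in>I. f i v) a b c d = (\<Sum>i\<in>I. pol (f i) a b c d)"
  by (simp add: pol_def sum.distrib sum_subtractf)

lemma pol_comp:
  assumes "\<And>x y. g (x + y) = g x + g y"
  shows "pol (\<lambda>v. f (g v)) a b c d = pol f (g a) (g b) (g c) (g d)"
  by (simp add: pol_def assms)

context complex_vector_space
begin

text \<open>The full polarization of a product is a permanent. The 24 assignments of arguments to
  factors are grouped by the pair of arguments that \<open>w0\<close> and \<open>w1\<close>
  receive.\<close>

lemma pol_prod:
  assumes "lin w0" "lin w1" "lin w2" "lin w3"
  defines "P \<equiv> \<lambda>a b. w0 a * w1 b + w0 b * w1 a" and "R \<equiv> \<lambda>a b. w2 a * w3 b + w2 b * w3 a"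
  shows "pol (\<lambda>v. w0 v * w1 v * w2 v * w3 v) a b c d =
    P a b * R c d + P a c * R b d + P a d * R b c + P b c * R a d + P b d * R a c + P c d * R a b"
  unfolding pol_def P_def R_def lin_add[OF assms(1)] lin_add[OF assms(2)] lin_add[OF assms(3)] lin_add[OF assms(4)]
  by algebra

section \<open>Quadrilinear forms and the six brackets\<close>

definition quadlin :: "('v \<Rightarrow> 'v \<Rightarrow> 'v \<Rightarrow> 'v \<Rightarrow> complex) \<Rightarrow> bool" where
  "quadlin Q \<longleftrightarrow> (\<forall>x y z. lin (\<lambda>v. Q v x y z) \<and> lin (\<lambda>v. Q x v y z) \<and> lin (\<lambda>v. Q x y v z) \<and> lin (\<lambda>v. Q x y z v))"

lemma prod_lessThan_4: "(\<Prod>j<4. h j) = h 0 * h 1 * h 2 * h (3::nat)"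
  for h :: "nat \<Rightarrow> complex"
  by (simp add: eval_nat_numeral mult.assoc)

lemma quadlin_pol:
  assumes "f \<in> sym_dual (*s) 4"
  shows "quadlin (pol f)"
  using assms unfolding hom_polys_def
proof (induction rule: cfun.span_induct_alt)
  case base
  then show ?case by (simp add: quadlin_def pol_def)
next
  case (step c x y)
  then obtain l where l: "\<And>i::nat. i < 4 \<Longrightarrow> lin (l i)" and x: "x = (\<lambda>v. l 0 v * l 1 v * l 2 v * l 3 v)"
    by (force simp: linear_iff_lin prod_lessThan_4)
  have l4: "lin (l 0)" "lin (l 1)" "lin (l 2)" "lin (l 3)" using l by auto
  have eq: "pol (cfun_scale c x + y) = (\<lambda>v1 v2 v3 v4. c * pol x v1 v2 v3 v4 + pol y v1 v2 v3 v4)"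
    by (simp add: fun_eq_iff pol_plus pol_scale)
  have "quadlin (pol x)"
    unfolding x pol_prod[OF l4] quadlin_def
    by (intro allI conjI) (intro lin_plus lin_cmult lin_multc l4)+
  then show ?case using step(2) unfolding eq quadlin_def
    by (intro allI conjI lin_plus lin_cmult) auto
qed

text \<open>In the symbolic form of the highest weight vector, \<open>p1, p2\<close> fill the two brackets
  \<open>[x y\<^sub>1 \<dots>]\<close>, \<open>p3, p4\<close> the two brackets \<open>[x' y\<^sub>1 \<dots>]\<close>, and \<open>(c0, c1)\<close>, \<open>(c2, c3)\<close> the two brackets
  \<open>[x x']\<close>.\<close>

definition kern where
  "kern n Q c0 c1 c2 c3 p1 p2 p3 p4 =
     Q (p1 0) (p2 0) c0 c2 * Q (p3 0) (p4 0) c1 c3 * (\<Prod>i\<in>{1..<n}. Q (p1 i) (p2 i) (p3 i) (p4 i) :: complex)"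
  for Q :: "'v \<Rightarrow> 'v \<Rightarrow> 'v \<Rightarrow> 'v \<Rightarrow> complex" and p1 p2 p3 p4 :: "nat \<Rightarrow> 'v"

text \<open>Only the four brackets of length \<open>n\<close> are carried out. As a function of
  \<open>c0, c1, c2, c3\<close> the result is the tensor that still has to be contracted with the
  two short brackets.\<close>

definition brack where
  "brack n Q c0 c1 c2 c3 b1 b2 b3 b4 =
     alt n (\<lambda>p1. alt n (\<lambda>p2. alt n (\<lambda>p3. alt n (\<lambda>p4. kern n Q c0 c1 c2 c3 p1 p2 p3 p4) b4) b3) b2) b1"

definition hw_form where
  "hw_form n Q b1 b2 b3 b4 d1 d2 =
     alt 2 (\<lambda>q1. alt 2 (\<lambda>q2. brack n Q (q1 0) (q1 1) (q2 0) (q2 1) b1 b2 b3 b4) d2) d1"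

lemma multilin_prod_split:
  assumes n: "n \<ge> 1" and "lin \<phi>" and "\<And>i. i < n \<Longrightarrow> lin (\<psi> i)"
  shows "multilin n (\<lambda>p. \<phi> (p 0) * (\<Prod>i\<in>{1..<n}. \<psi> i (p i)))"
proof -
  have "multilin n (\<lambda>p. \<Prod>i<n. (if i = 0 then \<phi> else \<psi> i) (p i))"
    using assms by (intro multilin_prod) auto
  moreover have "{..<n} = insert 0 {1..<n}" using n by auto
  then have "(\<Prod>i<n. (if i = 0 then \<phi> else \<psi> i) (p i)) = \<phi> (p 0) * (\<Prod>i\<in>{1..<n}. \<psi> i (p i))" for p
    by (auto intro!: prod.cong)
  ultimately show ?thesis by simp
qed

lemma multilin_kern:
  assumes Q: "quadlin Q" and n: "n \<ge> 1"
  shows "multilin n (\<lambda>p. kern n Q c0 c1 c2 c3 p p2 p3 p4)"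
    and "multilin n (\<lambda>p. kern n Q c0 c1 c2 c3 p1 p p3 p4)"
    and "multilin n (\<lambda>p. kern n Q c0 c1 c2 c3 p1 p2 p p4)"
    and "multilin n (\<lambda>p. kern n Q c0 c1 c2 c3 p1 p2 p3 p)"
  unfolding kern_def
  using Q[unfolded quadlin_def]
  by (intro multilin_prod_split[OF n, of "\<lambda>x. _ x _ _ _ * _" "\<lambda>i x. _ x (p2 i) (p3 i) (p4 i)"] 
       multilin_prod_split[OF n, of "\<lambda>x. _ _ x _ _ * _" "\<lambda>i x. _ (p1 i) x (p3 i) (p4 i)"]
       multilin_prod_split[OF n, of "\<lambda>x. _ * _ x _ _ _" "\<lambda>i x. _ (p1 i) (p2 i) x (p4 i)"]
       multilin_prod_split[OF n, of "\<lambda>x. _ * _ _ x _ _" "\<lambda>i x. _ (p1 i) (p2 i) (p3 i) x"]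
       lin_multc lin_cmult; simp)+

lemma lin_kern:
  assumes Q: "quadlin Q"
  shows "lin (\<lambda>c. kern n Q c c1 c2 c3 p1 p2 p3 p4)"
    and "lin (\<lambda>c. kern n Q c0 c c2 c3 p1 p2 p3 p4)"
    and "lin (\<lambda>c. kern n Q c0 c1 c c3 p1 p2 p3 p4)"
    and "lin (\<lambda>c. kern n Q c0 c1 c2 c p1 p2 p3 p4)"
  unfolding kern_def
  using Q[unfolded quadlin_def] by (intro lin_multc lin_cmult; simp)+

lemma lin_brack:
  assumes Q: "quadlin Q"
  shows "lin (\<lambda>c. brack n Q c c1 c2 c3 p1 p2 p3 p4)"
    and "lin (\<lambda>c. brack n Q c0 c c2 c3 p1 p2 p3 p4)"
    and "lin (\<lambda>c. brack n Q c0 c1 c c3 p1 p2 p3 p4)"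
    and "lin (\<lambda>c. brack n Q c0 c1 c2 c p1 p2 p3 p4)"
  unfolding brack_def by (intro lin_alt_fun lin_kern[OF Q])+

lemma alternating_brack:
  assumes Q: "quadlin Q" and n: "n \<ge> 1"
  shows "alternating n (\<lambda>p. brack n Q c0 c1 c2 c3 p p2 p3 p4)"
    and "alternating n (\<lambda>p. brack n Q c0 c1 c2 c3 p1 p p3 p4)"
    and "alternating n (\<lambda>p. brack n Q c0 c1 c2 c3 p1 p2 p p4)"
    and "alternating n (\<lambda>p. brack n Q c0 c1 c2 c3 p1 p2 p3 p)"
proof -
  note m = multilin_kern[OF Q n]
  show "alternating n (\<lambda>p. brack n Q c0 c1 c2 c3 p p2 p3 p4)"
    unfolding brack_def by (intro alternating_alt multilin_alt_fun m)
  show "alternating n (\<lambda>p. brack n Q c0 c1 c2 c3 p1 p p3 p4)"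
    unfolding brack_def by (intro alternating_alt_fun alternating_alt multilin_alt_fun m)
  show "alternating n (\<lambda>p. brack n Q c0 c1 c2 c3 p1 p2 p p4)"
    unfolding brack_def by (intro alternating_alt_fun alternating_alt multilin_alt_fun m)
  show "alternating n (\<lambda>p. brack n Q c0 c1 c2 c3 p1 p2 p3 p)"
    unfolding brack_def by (intro alternating_alt_fun alternating_alt multilin_alt_fun m)
qed

lemma brack_scale:
  assumes Q: "quadlin Q" and n: "n \<ge> 1"
    and v: "\<And>A. alternating n A \<Longrightarrow> A v = \<epsilon> * A u"
  shows "brack n Q c0 c1 c2 c3 v v v v = \<epsilon> ^ 4 * brack n Q c0 c1 c2 c3 u u u u"
  using v[OF alternating_brack(1)[OF Q n], of c0 c1 c2 c3 v v v]
    v[OF alternating_brack(2)[OF Q n], of c0 c1 c2 c3 u v v]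
    v[OF alternating_brack(3)[OF Q n], of c0 c1 c2 c3 u u v]
    v[OF alternating_brack(4)[OF Q n], of c0 c1 c2 c3 u u u]
  by (simp add: eval_nat_numeral)

lemma multilin_2:
  assumes "\<And>y. lin (\<lambda>x. T x y)" "\<And>x. lin (\<lambda>y. T x y)"
  shows "multilin 2 (\<lambda>q. T (q 0) (q 1))"
  unfolding multilin_def using assms by (auto simp: less_2_cases_iff)

lemma alternating_hw_form:
  assumes Q: "quadlin Q"
  shows "alternating 2 (\<lambda>p. hw_form n Q b1 b2 b3 b4 p d2)"
    and "alternating 2 (\<lambda>p. hw_form n Q b1 b2 b3 b4 d1 p)"
  unfolding hw_form_def
  by (intro alternating_alt_fun alternating_alt multilin_alt_fun multilin_2 lin_alt_fun lin_brack[OF Q])+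

text \<open>Each of the four long brackets contributes \<open>\<epsilon>\<close> and each of the two
  short ones \<open>\<eta>\<close>; this is the source of the weight.\<close>

lemma hw_form_scale:
  assumes Q: "quadlin Q" and n: "n \<ge> 1"
    and v: "\<And>A. alternating n A \<Longrightarrow> A v = \<epsilon> * A u"
    and v2: "\<And>A. alternating 2 A \<Longrightarrow> A v = \<eta> * A u"
  shows "hw_form n Q v v v v v v = \<epsilon> ^ 4 * \<eta> ^ 2 * hw_form n Q u u u u u u"
proof -
  have brack: "brack n Q c0 c1 c2 c3 v v v v = \<epsilon> ^ 4 * brack n Q c0 c1 c2 c3 u u u u" for c0 c1 c2 c3
    by (rule brack_scale[OF Q n]) (rule v)
  have "hw_form n Q v v v v v v = \<eta> ^ 2 * hw_form n Q v v v v u u"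
    using v2[OF alternating_hw_form(1)[OF Q], of n v v v v v] v2[OF alternating_hw_form(2)[OF Q], of n v v v v u]
    by (simp add: power2_eq_square)
  also have "hw_form n Q v v v v u u = \<epsilon> ^ 4 * hw_form n Q u u u u u u"
    unfolding hw_form_def by (simp add: brack alt_def sum_distrib_left mult.assoc mult.left_commute)
  finally show ?thesis by (simp add: mult_ac)
qed

lemma alt_comp: "alt n T (g \<circ> b) = alt n (\<lambda>p. T (g \<circ> p)) b"
  by (simp add: alt_def comp_assoc)

lemma brack_comp:
  "brack n Q (g c0) (g c1) (g c2) (g c3) (g \<circ> b1) (g \<circ> b2) (g \<circ> b3) (g \<circ> b4) =
   brack n (\<lambda>a b c d. Q (g a) (g b) (g c) (g d)) c0 c1 c2 c3 b1 b2 b3 b4"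
  unfolding brack_def alt_comp by (simp add: kern_def[abs_def])

lemma hw_form_comp:
  "hw_form n Q (g \<circ> b1) (g \<circ> b2) (g \<circ> b3) (g \<circ> b4) (g \<circ> d1) (g \<circ> d2) =
   hw_form n (\<lambda>a b c d. Q (g a) (g b) (g c) (g d)) b1 b2 b3 b4 d1 d2"
  unfolding hw_form_def alt_comp by (simp add: brack_comp)

lemma alt_2: "alt 2 T b = T b - T (b \<circ> Transposition.transpose 0 1)"
proof -
  have "{..<2::nat} = {0, 1}" by auto
  then have "{\<sigma>. \<sigma> permutes {..<2::nat}} = {id, Transposition.transpose 0 1}"
    by (auto simp: permutes_doubleton_iff)
  moreover have "Transposition.transpose 0 1 \<noteq> (id :: nat \<Rightarrow> nat)"
    by (metis id_apply transpose_apply_first zero_neq_one)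
  ultimately show ?thesis
    by (simp add: alt_def sign_swap_id)
qed

end

section \<open>Vanishing on sums of products of linear forms\<close>

context complex_vector_space
begin

text \<open>The matrix of the values \<open>w a (b j)\<close> is either singular or invertible. A
  relation between its columns gives a vector killed by all \<open>w a\<close>, normalized so that
  it may replace \<open>b k\<close>. An invertible matrix gives vectors dual to the forms whose span
  contains \<open>b\<close>.\<close>

lemma kernel_or_dual_basis:
  fixes w :: "nat \<Rightarrow> 'v \<Rightarrow> complex" and b :: "nat \<Rightarrow> 'v"
  assumes w: "\<And>a. a < n \<Longrightarrow> lin (w a)"
  obtains (kernel) v k where "k < n" "v - b k \<in> span (b ` ({..<n} - {k}))" "\<And>a. a < n \<Longrightarrow> w a v = 0"
  | (dual) u where "\<And>a c. a < n \<Longrightarrow> c < n \<Longrightarrow> w a (u c) = (if a = c then 1 else 0)"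
      "\<And>j. j < n \<Longrightarrow> b j \<in> span (u ` {..<n})"
proof -
  define m where "m j = (\<lambda>a. if a < n then w a (b j) else 0)" for j
  have wsum: "(\<Sum>j<n. cfun_scale (x j) (m j)) = (\<lambda>a. if a < n then w a (\<Sum>j<n. x j *s b j) else 0)" for x
    by (auto simp: fun_eq_iff sum_fun_apply fun_scale_def m_def lin_sum[OF w] lin_scale[OF w])
  show thesis
  proof (cases "\<exists>x k. k < n \<and> x k \<noteq> 0 \<and> (\<Sum>j<n. cfun_scale (x j) (m j)) = 0")
    case True
    then obtain x k where k: "k < n" "x k \<noteq> 0" and 0: "(\<Sum>j<n. cfun_scale (x j) (m j)) = 0" by auto
    define v where "v = inverse (x k) *s (\<Sum>j<n. x j *s b j)"
    have "v - b k = (\<Sum>j\<in>{..<n} - {k}. (inverse (x k) * x j) *s b j)"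
      using k by (simp add: v_def scale_sum_right scale_right_distrib sum.remove[of "{..<n}" k])
    also have "\<dots> \<in> span (b ` ({..<n} - {k}))"
      by (intro span_sum span_scale span_base) auto
    finally have "v - b k \<in> span (b ` ({..<n} - {k}))" .
    moreover have "w a v = 0" if "a < n" for a
      using fun_cong[OF 0[unfolded wsum], of a] that by (simp add: v_def lin_scale[OF w])
    ultimately show thesis using k(1) kernel by blast
  next
    case False
    then have ind: "x k = 0" if "k < n" "(\<Sum>j<n. cfun_scale (x j) (m j)) = 0" for x k
      using that by blast
    have inj: "inj_on m {..<n}"
    proof (rule inj_onI, rule ccontr)
      fix i j assume ij: "i \<in> {..<n}" "j \<in> {..<n}" "m i = m j" "i \<noteq> j"
      let ?x = "\<lambda>k. if k = i then 1 else if k = j then -1 else 0 :: complex"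
      have "(\<Sum>k<n. cfun_scale (?x k) (m k)) = (\<Sum>k\<in>{i, j}. cfun_scale (?x k) (m k))"
        using ij by (intro sum.mono_neutral_right) auto
      also have "\<dots> = 0" using ij by (simp add: fun_eq_iff fun_scale_def)
      finally show False using ind[of i ?x] ij by simp
    qed
    have indep: "cfun.independent (m ` {..<n})"
    proof (rule cfun.independent_if_scalars_zero)
      fix f x assume 0: "(\<Sum>x\<in>m ` {..<n}. cfun_scale (f x) x) = 0" and x: "x \<in> m ` {..<n}"
      from 0 have "(\<Sum>j<n. cfun_scale (f (m j)) (m j)) = 0"
        by (simp add: sum.reindex[OF inj])
      then show "f x = 0" using ind[of _ "\<lambda>j. f (m j)"] x by auto
    qed simp
    define E where "E = (\<lambda>c a. if a = c then 1 else 0 :: complex) ` {..<n}"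
    have "m j \<in> cfun.span E" for j
    proof -
      have "m j = (\<Sum>c<n. cfun_scale (m j c) (\<lambda>a. if a = c then 1 else 0))"
        by (auto simp: fun_eq_iff sum_fun_apply fun_scale_def m_def if_distrib cong: if_cong)
      also have "\<dots> \<in> cfun.span E"
        by (intro cfun.span_sum cfun.span_scale cfun.span_base) (auto simp: E_def)
      finally show ?thesis .
    qed
    then have mE: "m ` {..<n} \<subseteq> cfun.span E" by auto
    have E: "finite E" by (simp add: E_def)
    \<comment> \<open>At most \<open>n\<close> unit vectors span a space containing the
      \<open>n\<close> independent columns. A unit vector outside the span of the columns would
      enlarge them to an independent set bigger than \<open>E\<close>.\<close>
    have card: "card E \<le> card (m ` {..<n})"
      using card_image_le[of "{..<n}" "\<lambda>c a. if a = c then 1 else 0 :: complex"] inj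
      by (simp add: E_def card_image)
    have sp: "x \<in> cfun.span (m ` {..<n})" if "x \<in> E" for x
    proof (rule ccontr)
      assume x: "x \<notin> cfun.span (m ` {..<n})"
      then have "cfun.independent (insert x (m ` {..<n}))"
        using indep by (rule cfun.independent_insertI)
      moreover have "insert x (m ` {..<n}) \<subseteq> cfun.span E"
        using mE cfun.span_base[OF that] by blast
      ultimately have "card (insert x (m ` {..<n})) \<le> card E"
        using cfun.independent_span_bound[OF E] by blast
      moreover have "card (insert x (m ` {..<n})) = Suc (card (m ` {..<n}))"
        using x cfun.span_base[of x "m ` {..<n}"] by (intro card_insert_disjoint) auto
      ultimately show False using card by linarith
    qed
    have "\<exists>x. (\<lambda>a. if a = c then 1 else 0) = (\<Sum>j<n. cfun_scale (x j) (m j))" if "c < n" for c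
    proof -
      have "(\<lambda>a. if a = c then 1 else 0) \<in> cfun.span (m ` {..<n})"
        using that by (intro sp) (auto simp: E_def)
      then obtain f where "(\<lambda>a. if a = c then 1 else 0) = (\<Sum>x\<in>m ` {..<n}. cfun_scale (f x) x)"
        by (auto simp: cfun.span_finite)
      then show ?thesis by (auto simp: sum.reindex[OF inj] intro!: exI[of _ "\<lambda>j. f (m j)"])
    qed
    then obtain x where x: "\<And>c. c < n \<Longrightarrow> (\<lambda>a. if a = c then 1 else 0) = (\<Sum>j<n. cfun_scale (x c j) (m j))"
      by metis
    define u where "u c = (\<Sum>j<n. x c j *s b j)" for c
    have wu: "w a (u c) = (if a = c then 1 else 0)" if "a < n" "c < n" for a c
      using fun_cong[OF x[OF that(2), unfolded wsum], of a] that(1) by (simp add: u_def)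
    have "b j \<in> span (u ` {..<n})" if j: "j < n" for j
    proof -
      \<comment> \<open>Coefficients over \<open>b\<close> of \<open>b j\<close> minus its expansion
        in the dual vectors. All forms \<open>w a\<close> vanish on this difference, so the
        coefficients are zero by \<open>ind\<close>.\<close>
      define y where "y k = (if k = j then 1 else 0) - (\<Sum>a<n. w a (b j) * x a k)" for k
      have "(\<Sum>k<n. y k *s b k) = (\<Sum>k<n. (if k = j then b k else 0)) - (\<Sum>k<n. \<Sum>a<n. (w a (b j) * x a k) *s b k)"
        by (simp add: y_def scale_left_diff_distrib scale_sum_left sum_subtractf if_distrib[of "\<lambda>c. c *s _"] cong: if_cong)
      also have "(\<Sum>k<n. \<Sum>a<n. (w a (b j) * x a k) *s b k) = (\<Sum>a<n. w a (b j) *s u a)"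
        unfolding u_def scale_sum_right by (subst sum.swap) simp
      finally have yb: "(\<Sum>k<n. y k *s b k) = b j - (\<Sum>a<n. w a (b j) *s u a)"
        using j by simp
      have "(\<Sum>k<n. cfun_scale (y k) (m k)) = 0"
        unfolding wsum yb
        by (auto simp: fun_eq_iff lin_minus[OF w] lin_sum[OF w] lin_scale[OF w] wu if_distrib cong: if_cong)
      then have "y k = 0" if "k < n" for k using ind[OF that] by blast
      then have "b j = (\<Sum>a<n. w a (b j) *s u a)" using yb by simp
      also have "\<dots> \<in> span (u ` {..<n})"
        by (intro span_sum span_scale span_base) auto
      finally show ?thesis .
    qed
    with wu show thesis using dual by blast
  qed
qed

text \<open>Replacing \<open>b k\<close> by \<open>v\<close> does not change an alternating
  function. After the replacement every permutation puts \<open>v\<close> into an argument of some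
  factor \<open>Q\<close>, and each term is zero.\<close>

lemma brack_eq_0_kernel:
  assumes Q: "quadlin Q" and n: "n \<ge> 1" and k: "k < n"
    and v: "v - b k \<in> span (b ` ({..<n} - {k}))" and Qv: "\<And>x y z. Q v x y z = 0"
  shows "brack n Q c0 c1 c2 c3 b b2 b3 b4 = 0"
proof -
  have kern: "kern n Q c0 c1 c2 c3 p p2 p3 p4 = 0" if "i < n" "p i = v" for i p p2 p3 p4
  proof (cases "i = 0")
    case False
    then have "(\<Prod>i\<in>{1..<n}. Q (p i) (p2 i) (p3 i) (p4 i)) = 0"
      using that Qv by (intro prod_zero bexI[of _ i]) auto
    then show ?thesis by (simp add: kern_def)
  qed (use that Qv in \<open>simp add: kern_def\<close>)
  have "brack n Q c0 c1 c2 c3 (b(k := v)) b2 b3 b4 = 0"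
    unfolding brack_def alt_def[of n _ "b(k := v)"]
  proof (intro sum.neutral ballI)
    fix \<sigma> assume "\<sigma> \<in> {\<sigma>. \<sigma> permutes {..<n}}"
    then have s: "\<sigma> permutes {..<n}" by simp
    have "inv \<sigma> k < n" using permutes_in_image[OF permutes_inv[OF s]] k by blast
    moreover have "(b(k := v) \<circ> \<sigma>) (inv \<sigma> k) = v" using permutes_inverses[OF s] by simp
    ultimately have "kern n Q c0 c1 c2 c3 (b(k := v) \<circ> \<sigma>) p2 p3 p4 = 0" for p2 p3 p4
      using kern by blast
    then show "of_int (sign \<sigma>) * alt n (\<lambda>p2. alt n (\<lambda>p3. alt n (\<lambda>p4.
        kern n Q c0 c1 c2 c3 (b(k := v) \<circ> \<sigma>) p2 p3 p4) b4) b3) b2 = 0"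
      by (simp add: alt_def)
  qed
  then show ?thesis
    using alternating_replace[OF alternating_brack(1)[OF Q n] k, of v 1 b] v by simp
qed

text \<open>The symmetries of a sum of products of coordinates in a dual basis: the torus elements that
  scale two coordinates of one product by reciprocal factors, and the transpositions of two
  coordinates of one product.\<close>

context
  fixes n :: nat and w :: "nat \<Rightarrow> 'v \<Rightarrow> complex" and u :: "nat \<Rightarrow> 'v" and f r Q
  assumes n: "n = 4 * r" and r: "r \<ge> 1"
    and w: "\<And>a. a < n \<Longrightarrow> lin (w a)"
    and wu: "\<And>a c. a < n \<Longrightarrow> c < n \<Longrightarrow> w a (u c) = (if a = c then 1 else 0)"
    and f: "f = (\<lambda>v. \<Sum>i<r. \<Prod>j<4. w (4 * i + j) v)"
    and Q: "Q = pol f" "quadlin Q"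
begin

lemma n_pos: "n \<ge> 1" using n r by simp

lemma prod_block_split:
  assumes "x < n" "y < n" "x div 4 = y div 4" "x \<noteq> y" "x div 4 = i"
  shows "(\<Prod>j<4. h (4 * i + j)) = h x * h y * (\<Prod>j\<in>{..<4} - {x mod 4, y mod 4}. h (4 * i + j) :: complex)"
proof -
  have ne: "x mod 4 \<noteq> y mod 4" using assms by (metis mult_div_mod_eq)
  have "(\<Prod>j<4. h (4 * i + j)) = h (4 * i + x mod 4) * (\<Prod>j\<in>{..<4} - {x mod 4}. h (4 * i + j))"
    by (rule prod.remove) auto
  also have "(\<Prod>j\<in>{..<4} - {x mod 4}. h (4 * i + j)) = h (4 * i + y mod 4) * (\<Prod>j\<in>{..<4} - {x mod 4} - {y mod 4}. h (4 * i + j))"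
    using ne by (intro prod.remove) auto
  also have "{..<4} - {x mod 4} - {y mod 4} = {..<4} - {x mod 4, y mod 4}" by auto
  also have "4 * i + x mod 4 = x" using assms(5) by auto
  also have "4 * i + y mod 4 = y" using assms(3,5) by auto
  finally show ?thesis by (simp add: mult.assoc)
qed

text \<open>The coordinates \<open>x\<close> and \<open>y\<close> are two factors of the same
  product, so \<open>g\<close> may change them as long as their product is kept.\<close>

lemma f_invariant:
  assumes xy: "x < n" "y < n" "x div 4 = y div 4" "x \<noteq> y"
    and g: "\<And>a v. a < n \<Longrightarrow> a \<noteq> x \<Longrightarrow> a \<noteq> y \<Longrightarrow> w a (g v) = w a v"
    and gxy: "\<And>v. w x (g v) * w y (g v) = w x v * w y v"
  shows "f (g v) = f v"
  unfolding f
proof (rule sum.cong[OF refl])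
  fix i assume "i \<in> {..<r}"
  then have lt: "4 * i + j < n" if "j < 4" for j using that n by auto
  show "(\<Prod>j<4. w (4 * i + j) (g v)) = (\<Prod>j<4. w (4 * i + j) v)"
  proof (cases "x div 4 = i")
    case True
    have "4 * i + j \<noteq> x" "4 * i + j \<noteq> y" if "j \<in> {..<4} - {x mod 4, y mod 4}" for j
    proof -
      have "(4 * i + j) mod 4 = j" using that by simp
      then show "4 * i + j \<noteq> x" "4 * i + j \<noteq> y" using that by auto
    qed
    then have "(\<Prod>j\<in>{..<4} - {x mod 4, y mod 4}. w (4 * i + j) (g v)) =
      (\<Prod>j\<in>{..<4} - {x mod 4, y mod 4}. w (4 * i + j) v)"
      by (intro prod.cong[OF refl] g lt) auto
    then show ?thesis
      unfolding prod_block_split[OF xy True, of "\<lambda>a. w a _"] by (simp add: gxy)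
  next
    case False
    then have "4 * i + j \<noteq> x" "4 * i + j \<noteq> y" if "j < 4" for j
      using that xy by auto
    then show ?thesis by (intro prod.cong[OF refl] g lt) auto
  qed
qed

lemma brack_invariant:
  assumes add: "\<And>v v'. g (v + v') = g v + g v'" and inv: "\<And>v. f (g v) = f v"
  shows "brack n Q c0 c1 c2 c3 u u u u = brack n Q (g c0) (g c1) (g c2) (g c3) (g \<circ> u) (g \<circ> u) (g \<circ> u) (g \<circ> u)"
proof -
  have "Q (g a) (g b) (g c) (g d) = Q a b c d" for a b c d
    unfolding Q pol_comp[OF add, symmetric] by (simp add: inv)
  then show ?thesis by (simp add: brack_comp)
qed

text \<open>The torus element has determinant 1 on the span of \<open>u\<close> and fixes
  \<open>f\<close>, so the long brackets do not change and only the weights of the four open slots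
  remain. A total weight different from 1 forces the value to be zero.\<close>

lemma brack_torus:
  assumes xy: "x < n" "y < n" "x div 4 = y div 4" "x \<noteq> y"
    and abcd: "a < n" "b < n" "c < n" "d < n"
  defines "t \<equiv> \<lambda>k. if k = x then 2 else if k = y then 1 / 2 else 1 :: complex"
  shows "brack n Q (u a) (u b) (u c) (u d) u u u u = t a * t b * t c * t d * brack n Q (u a) (u b) (u c) (u d) u u u u"
proof -
  \<comment> \<open>Acts as 2 on \<open>u x\<close>, as 1/2 on \<open>u y\<close>, and trivially on
    the common kernel of \<open>w x\<close> and \<open>w y\<close>.\<close>
  define g where "g v = v + w x v *s u x - (w y v / 2) *s u y" for v
  have add: "g (v + v') = g v + g v'" for v v'
    by (simp add: g_def lin_add[OF w] xy scale_left_distrib add_divide_distrib algebra_simps)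
  have wg: "w k (g v) = t k * w k v" if "k < n" for k v
    using that xy by (auto simp: g_def t_def lin_add[OF w] lin_minus[OF w] lin_scale[OF w] wu)
  have gu: "g (u k) = t k *s u k" if "k < n" for k
  proof -
    have "u y - (1 / 2) *s u y = (1 - 1 / 2) *s u y"
      by (simp only: scale_left_diff_distrib scale_one)
    moreover have "u x + u x = 2 *s u x" 
      using scale_left_distrib[of 1 1 "u x"] by simp
    ultimately show ?thesis using that xy by (auto simp: g_def t_def wu)
  qed
  have "f (g v) = f v" for v
    by (rule f_invariant[OF xy]) (use xy in \<open>auto simp: wg t_def\<close>)
  then have "brack n Q (u a) (u b) (u c) (u d) u u u u =
    brack n Q (g (u a)) (g (u b)) (g (u c)) (g (u d)) (g \<circ> u) (g \<circ> u) (g \<circ> u) (g \<circ> u)"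
    by (rule brack_invariant[OF add])
  also have "\<dots> = 1 ^ 4 * brack n Q (g (u a)) (g (u b)) (g (u c)) (g (u d)) u u u u"
  proof (rule brack_scale[OF Q(2) n_pos])
    fix A assume A: "alternating n A"
    have "A (g \<circ> u) = A (u(x := 2 *s u x, y := (1 / 2) *s u y))"
      by (rule multilin_cong[OF alternating_multilin[OF A]]) (use xy in \<open>auto simp: gu t_def\<close>)
    also have "\<dots> = (1 / 2) * A (u(x := 2 *s u x))"
      using lin_scale[OF multilin_lin[OF alternating_multilin[OF A] xy(2), of "u(x := 2 *s u x)"], of "1 / 2" "u y"]
        fun_upd_triv[of "u(x := 2 *s u x)" y] xy(4)
      by (simp del: fun_upd_triv)
    also have "A (u(x := 2 *s u x)) = 2 * A u"
      using lin_scale[OF multilin_lin[OF alternating_multilin[OF A] xy(1), of u], of 2 "u x"] by simp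
    finally show "A (g \<circ> u) = 1 * A u" by (simp only: mult_1 field_simps) simp
  qed
  finally show ?thesis
    using abcd by (simp add: gu lin_brack[OF Q(2), THEN lin_scale] mult_ac)
qed

text \<open>The transposition fixes \<open>f\<close> and has determinant -1, which the four long
  brackets raise to an even power.\<close>

lemma brack_swap:
  assumes xy: "x < n" "y < n" "x div 4 = y div 4" "x \<noteq> y"
    and cd: "c < n" "d < n" "c \<noteq> x" "c \<noteq> y" "d \<noteq> x" "d \<noteq> y"
  shows "brack n Q (u x) (u y) (u c) (u d) u u u u = brack n Q (u y) (u x) (u c) (u d) u u u u"
proof -
  \<comment> \<open>The reflection that exchanges \<open>u x\<close> and \<open>u y\<close>.\<close>
  define g where "g v = v + (w x v - w y v) *s (u y - u x)" for v
  have add: "g (v + v') = g v + g v'" for v v'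
    by (simp add: g_def lin_add[OF w] xy scale_left_distrib algebra_simps)
  have wg: "w k (g v) = w (Transposition.transpose x y k) v" if "k < n" for k v
    using that xy by (auto simp: g_def transpose_def lin_add[OF w] lin_minus[OF w] lin_scale[OF w] wu)
  have gu: "g (u k) = u (Transposition.transpose x y k)" if "k < n" for k
    using that xy by (auto simp: g_def transpose_def wu)
  have "f (g v) = f v" for v
    by (rule f_invariant[OF xy]) (use xy in \<open>auto simp: wg\<close>)
  then have "brack n Q (u x) (u y) (u c) (u d) u u u u =
    brack n Q (g (u x)) (g (u y)) (g (u c)) (g (u d)) (g \<circ> u) (g \<circ> u) (g \<circ> u) (g \<circ> u)"
    by (rule brack_invariant[OF add])
  also have "\<dots> = (-1) ^ 4 * brack n Q (g (u x)) (g (u y)) (g (u c)) (g (u d)) u u u u"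
  proof (rule brack_scale[OF Q(2) n_pos])
    fix A assume A: "alternating n A"
    have "A (g \<circ> u) = A (u \<circ> Transposition.transpose x y)"
      by (rule multilin_cong[OF alternating_multilin[OF A]]) (auto simp: gu)
    then show "A (g \<circ> u) = -1 * A u"
      using alternating_swap[OF A xy(1,2,4)] by simp
  qed
  finally show ?thesis using cd xy by (simp add: gu)
qed

text \<open>If an index of the block of \<open>a\<close> does not occur among the four, the torus
  kills both sides. Otherwise the four indices fill the block, each once, and the transposition of
  \<open>a\<close> and \<open>b\<close> gives the equality.\<close>

lemma brack_symmetric_basis:
  assumes abcd: "a < n" "b < n" "c < n" "d < n"
  shows "brack n Q (u a) (u b) (u c) (u d) u u u u = brack n Q (u b) (u a) (u c) (u d) u u u u"
proof (cases "\<exists>y. y div 4 = a div 4 \<and> y \<notin> {a, b, c, d}")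
  case True
  then obtain y where y: "y div 4 = a div 4" "y \<notin> {a, b, c, d}" by auto
  moreover have "y < n"
  proof -
    have "a div 4 < r" using abcd(1) n by auto
    then show ?thesis using y(1) n by (metis div_less_iff_less_mult mult.commute zero_less_numeral)
  qed
  ultimately have xy: "a < n" "y < n" "a div 4 = y div 4" "a \<noteq> y" using abcd by auto
  let ?t = "\<lambda>k. if k = a then 2 else if k = y then 1 / 2 else 1 :: complex"
  \<comment> \<open>\<open>a\<close> contributes a factor 2 and the factor 1/2 never occurs, so the
    weight is a power of 2 with positive exponent.\<close>
  have "?t a * ?t b * ?t c * ?t d \<noteq> 1" using y(2) by auto
  then have "brack n Q (u a) (u b) (u c) (u d) u u u u = 0"
    using brack_torus[OF xy abcd] by (metis mult_cancel_right1 mult.commute)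
  moreover have "?t b * ?t a * ?t c * ?t d \<noteq> 1" using y(2) by auto
  then have "brack n Q (u b) (u a) (u c) (u d) u u u u = 0"
    using brack_torus[OF xy abcd(2,1,3,4)] by (metis mult_cancel_right1 mult.commute)
  ultimately show ?thesis by simp
next
  case False
  moreover have "(4 * (a div 4) + j) div 4 = a div 4" if "j < 4" for j
    using that by simp
  ultimately have sub: "(\<lambda>j. 4 * (a div 4) + j) ` {..<4} \<subseteq> {a, b, c, d}" by blast
  have "card ((\<lambda>j. 4 * (a div 4) + j) ` {..<4}) = 4" by (subst card_image) auto
  with sub have "card {a, b, c, d} \<ge> 4" by (metis card_mono finite.emptyI finite_insert)
  then have dist: "a \<noteq> b" "c \<noteq> a" "c \<noteq> b" "d \<noteq> a" "d \<noteq> b" "c \<noteq> d"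
    by (auto simp: card_insert_if split: if_splits)
  then have "card {a, b, c, d} = 4" by auto
  with sub \<open>card (_ ` _) = 4\<close> have "(\<lambda>j. 4 * (a div 4) + j) ` {..<4} = {a, b, c, d}"
    by (metis card_subset_eq finite.emptyI finite_insert)
  then have "b \<in> (\<lambda>j. 4 * (a div 4) + j) ` {..<4}" by simp
  then have "a div 4 = b div 4" by auto
  then show ?thesis using brack_swap[of a b c d] abcd dist by simp
qed

text \<open>The symmetry on dual vectors extends first through the four open slots by linearity,
  then through the four long brackets by \<open>alternating_eq_0_on_span\<close>, one argument at a
  time.\<close>

lemma brack_symmetric_dual:
  assumes c: "c0 \<in> span (u ` {..<n})" "c1 \<in> span (u ` {..<n})" "c2 \<in> span (u ` {..<n})" "c3 \<in> span (u ` {..<n})"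
    and b: "\<And>j. j < n \<Longrightarrow> b j \<in> span (u ` {..<n})"
  shows "brack n Q c0 c1 c2 c3 b b b b = brack n Q c1 c0 c2 c3 b b b b"
proof -
  let ?E = "\<lambda>c0 c1 c2 c3 b1 b2 b3 b4. brack n Q c0 c1 c2 c3 b1 b2 b3 b4 - brack n Q c1 c0 c2 c3 b1 b2 b3 b4"
  note lin = lin_brack[OF Q(2)] and alternating = alternating_brack[OF Q(2) n_pos]
  have "?E (u i) (u j) (u k) (u l) u u u u = 0" if "i < n" "j < n" "k < n" "l < n" for i j k l
    using brack_symmetric_basis[OF that] by simp
  \<comment> \<open>The first two open slots trade places in the subtracted term, hence
    \<open>lin(1,2)\<close> here and \<open>lin(2,1)\<close> next.\<close>
  then have "?E c0 (u j) (u k) (u l) u u u u = 0" if "j < n" "k < n" "l < n" for j k l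
    using that by (intro lin_eq_0_on_span[OF lin_diff[OF lin(1,2)] _ c(1)]) auto
  then have "?E c0 c1 (u k) (u l) u u u u = 0" if "k < n" "l < n" for k l
    using that by (intro lin_eq_0_on_span[OF lin_diff[OF lin(2,1)] _ c(2)]) auto
  then have "?E c0 c1 c2 (u l) u u u u = 0" if "l < n" for l
    using that by (intro lin_eq_0_on_span[OF lin_diff[OF lin(3,3)] _ c(3)]) auto
  then have "?E c0 c1 c2 c3 u u u u = 0"
    by (intro lin_eq_0_on_span[OF lin_diff[OF lin(4,4)] _ c(4)]) auto
  then have "?E c0 c1 c2 c3 b u u u = 0"
    by (rule alternating_eq_0_on_span[OF alternating_diff[OF alternating(1,1)]]) (rule b)
  then have "?E c0 c1 c2 c3 b b u u = 0"
    by (rule alternating_eq_0_on_span[OF alternating_diff[OF alternating(2,2)]]) (rule b)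
  then have "?E c0 c1 c2 c3 b b b u = 0"
    by (rule alternating_eq_0_on_span[OF alternating_diff[OF alternating(3,3)]]) (rule b)
  then have "?E c0 c1 c2 c3 b b b b = 0"
    by (rule alternating_eq_0_on_span[OF alternating_diff[OF alternating(4,4)]]) (rule b)
  then show ?thesis by simp
qed

end

text \<open>The tensor left open by the long brackets is symmetric in \<open>c0, c1\<close>, whereas
  the short bracket filled by them is antisymmetric.\<close>

lemma hw_form_eq_0:
  assumes r: "r \<ge> 1" and w: "\<And>a. a < 4 * r \<Longrightarrow> lin (w a)"
    and f: "f = (\<lambda>v. \<Sum>i<r. \<Prod>j<4. w (4 * i + j) v)" and Q: "quadlin (pol f)"
  shows "hw_form (4 * r) (pol f) b b b b b b = 0"
proof -
  let ?n = "4 * r"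
  have n: "?n \<ge> 1" "0 < ?n" "1 < ?n" using r by auto
  have sym: "brack ?n (pol f) (b i) (b j) (b k) (b l) b b b b = brack ?n (pol f) (b j) (b i) (b k) (b l) b b b b"
    if ijkl: "i < ?n" "j < ?n" "k < ?n" "l < ?n" for i j k l
    using w
  proof (cases rule: kernel_or_dual_basis[of ?n w b, case_names lin kernel dual])
    case (kernel v m)
    \<comment> \<open>All linear factors vanish on \<open>v\<close>, so \<open>f\<close> is
      invariant under translation by \<open>v\<close>. The terms of the polarization then cancel in
      pairs, up to \<open>f v = f 0 = 0\<close>.\<close>
    have "pol f v x y z = 0" for x y z
    proof -
      have "w (4 * i + j) (v + x) = w (4 * i + j) x" if "i < r" "j < 4" for i j x
        using w kernel(3) that by (subst lin_add) auto
      then have shift: "f (v + x) = f x" for x by (simp add: f)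
      have "f 0 = 0" using w by (auto simp: f lin_zero)
      then show ?thesis using shift shift[of 0] by (simp add: pol_def add.assoc)
    qed
    then show ?thesis
      using brack_eq_0_kernel[OF Q n(1) kernel(1,2)] by simp
  next
    case (dual u)
    show ?thesis
      by (rule brack_symmetric_dual[OF refl r w dual(1) f refl Q]) (use dual(2) ijkl in auto)
  qed
  show ?thesis unfolding hw_form_def alt_2 using sym n by (simp)
qed

end

section \<open>Nonvanishing\<close>

context complex_vector_space
begin

lemma alt_sum: "alt n (\<lambda>p. \<Sum>i\<in>I. T i p) b = (\<Sum>i\<in>I. alt n (T i) b)"
  unfolding alt_def sum_distrib_left by (rule sum.swap)

lemma alt_cmult: "alt n (\<lambda>p. c * T p) b = c * alt n T b"
  and alt_multc: "alt n (\<lambda>p. T p * c) b = alt n T b * c"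
  by (simp_all add: alt_def sum_distrib_left sum_distrib_right mult_ac)

lemma alt_in_Reals: "(\<And>\<sigma>. \<sigma> permutes {..<n} \<Longrightarrow> T (b \<circ> \<sigma>) \<in> \<real>) \<Longrightarrow> alt n T b \<in> \<real>"
  unfolding alt_def by (auto intro!: sum_in_Reals Reals_mult)

lemma alt_eq_id_term:
  assumes "\<And>\<sigma>. \<sigma> permutes {..<n} \<Longrightarrow> \<sigma> \<noteq> id \<Longrightarrow> T (b \<circ> \<sigma>) = 0"
  shows "alt n T b = T b"
proof -
  have "alt n T b = (\<Sum>\<sigma>\<in>{id}. of_int (sign \<sigma>) * T (b \<circ> \<sigma>))"
    unfolding alt_def
    by (rule sum.mono_neutral_right) (use assms in \<open>auto simp: finite_permutations permutes_id\<close>)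
  then show ?thesis by simp
qed

text \<open>On a sum of fourth powers of linear forms with real coordinates, the six brackets turn into
  a sum of squares of products of determinants.\<close>

lemma hw_form_ne_0:
  fixes L :: "nat \<Rightarrow> 'v \<Rightarrow> complex" and e :: "nat \<Rightarrow> 'v"
  assumes n: "n \<ge> 2"
    and Le: "\<And>k j. k < n \<Longrightarrow> j < n \<Longrightarrow> L k (e j) = (if k = j then 1 else 0)"
    and Ln: "\<And>v. L n v = L 0 v + L 1 v"
    and Q: "Q = (\<lambda>a b c d. \<Sum>k\<le>n. L k a * L k b * L k c * L k d)"
  shows "hw_form n Q e e e e e e \<noteq> 0"
proof -
  \<comment> \<open>A triple \<open>(k, l, \<kappa>)\<close> chooses one summand from each factor of
    \<open>kern\<close>: \<open>k\<close> and \<open>l\<close> for the two factors with open slots,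
    \<open>\<kappa> i\<close> for the others.\<close>
  define I where "I = {..n} \<times> {..n} \<times> PiE {1..<n} (\<lambda>_. {..n})"
  define D where "D k \<kappa> p = L k (p 0) * (\<Prod>i\<in>{1..<n}. L (\<kappa> i) (p i))" for k and \<kappa> p :: "nat \<Rightarrow> _"
  define A where "A = (\<lambda>(k, l :: nat, \<kappa>). D k \<kappa>)"
  define B where "B = (\<lambda>(k :: nat, l, \<kappa>). D l \<kappa>)"
  define W where "W = (\<lambda>(k, l, \<kappa> :: nat \<Rightarrow> nat) (q :: nat \<Rightarrow> 'v). L k (q 0) * L l (q 1))"
  have fin: "finite I" unfolding I_def by (intro finite_cartesian_product finite_PiE) auto
  have kern: "kern n Q (q1 0) (q1 1) (q2 0) (q2 1) p1 p2 p3 p4 =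
      (\<Sum>x\<in>I. W x q1 * W x q2 * A x p1 * A x p2 * B x p3 * B x p4)" for q1 q2 p1 p2 p3 p4
  proof -
    have sum3: "(\<Sum>k\<le>n. f k) * (\<Sum>l\<le>n. g l) * (\<Sum>\<kappa>\<in>PiE {1..<n} (\<lambda>_. {..n}). h \<kappa>) =
        (\<Sum>(k, l, \<kappa>)\<in>I. f k * (g l * h \<kappa>))" for f g :: "nat \<Rightarrow> complex" and h
      unfolding I_def sum.cartesian_product[symmetric]
      by (simp only: mult.assoc sum_distrib_right) (simp only: sum_distrib_left)
    have prod: "(\<Prod>i\<in>{1..<n}. Q (p1 i) (p2 i) (p3 i) (p4 i)) = (\<Sum>\<kappa>\<in>PiE {1..<n} (\<lambda>_. {..n}).
        \<Prod>i\<in>{1..<n}. L (\<kappa> i) (p1 i) * L (\<kappa> i) (p2 i) * L (\<kappa> i) (p3 i) * L (\<kappa> i) (p4 i))"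
      unfolding Q by (rule prod_sum_PiE) auto
    show ?thesis
      unfolding kern_def prod unfolding Q sum3
      by (auto simp: A_def B_def W_def D_def prod.distrib mult_ac intro!: sum.cong)
  qed
  define X where "X x = alt n (A x) e * alt n (B x) e * alt 2 (W x) e" for x
  have brack: "brack n Q (q1 0) (q1 1) (q2 0) (q2 1) e e e e =
      (\<Sum>x\<in>I. W x q1 * W x q2 * alt n (A x) e * alt n (A x) e * alt n (B x) e * alt n (B x) e)" for q1 q2
    unfolding brack_def kern by (simp only: alt_sum alt_cmult alt_multc)
  have "hw_form n Q e e e e e e = (\<Sum>x\<in>I. alt 2 (W x) e * alt 2 (W x) e *
      alt n (A x) e * alt n (A x) e * alt n (B x) e * alt n (B x) e)"
    unfolding hw_form_def brack by (simp only: alt_sum alt_cmult alt_multc)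
  also have "\<dots> = (\<Sum>x\<in>I. (X x)\<^sup>2)"
    by (simp only: X_def power2_eq_square mult_ac)
  also have "\<dots> = (\<Sum>x\<in>I. of_real ((Re (X x))\<^sup>2))"
  proof (rule sum.cong[OF refl])
    fix x assume "x \<in> I"
    then obtain k l \<kappa> where x: "x = (k, l, \<kappa>)" "k \<le> n" "l \<le> n" "\<And>i. i \<in> {1..<n} \<Longrightarrow> \<kappa> i \<le> n"
      by (auto simp: I_def PiE_def Pi_def)
    have L: "L k (e j) \<in> \<real>" if "k \<le> n" "j < n" for k j
      using that n Le by (cases "k = n") (auto simp: Ln)
    have D: "alt n (D k \<kappa>) e \<in> \<real>" if "k \<le> n" for k
    proof (rule alt_in_Reals)
      fix \<sigma> assume \<sigma>: "\<sigma> permutes {..<n}"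
      have "\<sigma> i < n" if "i < n" for i using permutes_in_image[OF \<sigma>, of i] that by simp
      then show "D k \<kappa> (e \<circ> \<sigma>) \<in> \<real>"
        using that n x(4) unfolding D_def by (auto intro!: Reals_mult prod_in_Reals L)
    qed
    have "alt 2 (W x) e \<in> \<real>"
      using x n by (auto simp: alt_2 W_def intro!: Reals_mult Reals_diff L)
    then have "X x \<in> \<real>"
      using D x by (auto simp: X_def A_def B_def intro!: Reals_mult)
    then show "(X x)\<^sup>2 = of_real ((Re (X x))\<^sup>2)"
      by (auto elim: Reals_cases)
  qed
  also have "\<dots> = of_real (\<Sum>x\<in>I. (Re (X x))\<^sup>2)" by simp
  finally have hw_form: "hw_form n Q e e e e e e = of_real (\<Sum>x\<in>I. (Re (X x))\<^sup>2)" .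
  \<comment> \<open>A term that is not zero. With coordinate forms alone, two nonzero long brackets
    would force \<open>k = l\<close>, and the short one would vanish. Choosing \<open>l = n\<close>,
    where \<open>L n\<close> is the sum of \<open>L 0\<close> and \<open>L 1\<close>, makes all
    three determinants 1.\<close>
  define x where "x = (0 :: nat, n, restrict id {1..<n})"
  have x: "x \<in> I" by (auto simp: x_def I_def)
  have off_diagonal: "\<exists>i\<in>{1..<n}. \<sigma> i \<noteq> i" if \<sigma>: "\<sigma> permutes {..<n}" "\<sigma> \<noteq> id" for \<sigma>
  proof (rule ccontr)
    assume "\<not> ?thesis"
    then have fix_pos: "\<sigma> i = i" if "i \<noteq> 0" for i
      using permutes_not_in[OF \<sigma>(1), of i] that by (cases "i < n") auto
    moreover from this have "\<sigma> 0 = 0"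
      using permutes_inj[OF \<sigma>(1)] by (metis injD)
    ultimately have "\<sigma> i = i" for i by (cases "i = 0") auto
    then show False using \<sigma>(2) by (auto simp: fun_eq_iff)
  qed
  have D: "alt n (D k (restrict id {1..<n})) e = 1" if "L k (e 0) = 1" for k
  proof -
    have "D k (restrict id {1..<n}) (e \<circ> \<sigma>) = 0" if \<sigma>: "\<sigma> permutes {..<n}" "\<sigma> \<noteq> id" for \<sigma>
    proof -
      obtain i where i: "i \<in> {1..<n}" "\<sigma> i \<noteq> i" using off_diagonal[OF \<sigma>] by auto
      have "\<sigma> i < n" using permutes_in_image[OF \<sigma>(1)] i by auto
      then have "L (restrict id {1..<n} i) ((e \<circ> \<sigma>) i) = 0" using i Le by simp
      then show ?thesis unfolding D_def using i by (auto intro!: prod_zero)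
    qed
    then have "alt n (D k (restrict id {1..<n})) e = D k (restrict id {1..<n}) e"
      by (rule alt_eq_id_term)
    also have "\<dots> = 1" unfolding D_def using that Le by (auto intro!: prod.neutral)
    finally show ?thesis .
  qed
  have "L 0 (e 0) = 1" "L n (e 0) = 1" "L 0 (e 1) = 0" "L n (e 1) = 1"
    using n by (simp_all add: Le Ln)
  then have "X x = 1"
    using D[of 0] D[of n] by (simp add: X_def A_def B_def x_def W_def alt_2 del: One_nat_def)
  then have "0 < (Re (X x))\<^sup>2" by simp
  also have "\<dots> \<le> (\<Sum>x\<in>I. (Re (X x))\<^sup>2)"
    using fin x by (intro member_le_sum) auto
  finally show ?thesis unfolding hw_form of_real_eq_0_iff by simp
qed

end

section \<open>Complete reducibility\<close>

text \<open>Hermitian form on coefficient vectors; it reads only the entries in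
  \<open>J\<close>.\<close>

definition inner_on :: "'j set \<Rightarrow> ('j \<Rightarrow> complex) \<Rightarrow> ('j \<Rightarrow> complex) \<Rightarrow> complex" where
  "inner_on J c d = (\<Sum>\<alpha>\<in>J. c \<alpha> * cnj (d \<alpha>))"

lemma inner_on_add: "inner_on J (c + c') d = inner_on J c d + inner_on J c' d"
  and inner_on_diff: "inner_on J (c - c') d = inner_on J c d - inner_on J c' d"
  and inner_on_scale: "inner_on J (cfun_scale k c) d = k * inner_on J c d"
  and inner_on_zero: "inner_on J 0 d = 0"
  by (simp_all add: inner_on_def fun_scale_def algebra_simps sum.distrib sum_subtractf sum_distrib_left)

lemma inner_on_add_right: "inner_on J c (d + d') = inner_on J c d + inner_on J c d'"
  and inner_on_scale_right: "inner_on J c (cfun_scale k d) = cnj k * inner_on J c d"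
  and inner_on_zero_right: "inner_on J c 0 = 0"
  by (simp_all add: inner_on_def fun_scale_def algebra_simps sum.distrib sum_distrib_left)

lemma inner_on_self: "inner_on J c c = of_real (\<Sum>\<alpha>\<in>J. (cmod (c \<alpha>))\<^sup>2)"
  by (simp add: inner_on_def complex_norm_square[symmetric])

lemma inner_on_self_eq_0: "finite J \<Longrightarrow> inner_on J c c = 0 \<Longrightarrow> \<alpha> \<in> J \<Longrightarrow> c \<alpha> = 0"
  unfolding inner_on_self of_real_eq_0_iff by (subst (asm) sum_nonneg_eq_0_iff) auto

lemma orthogonal_to_span:
  assumes "\<And>b. b \<in> B \<Longrightarrow> inner_on J c b = 0" "d \<in> cfun.span B"
  shows "inner_on J c d = 0"
  using assms(2)
proof (induction rule: cfun.span_induct_alt)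
  case base
  show ?case by (rule inner_on_zero_right)
next
  case (step k x y)
  then have "inner_on J c (cfun_scale k x + y) = 0"
    unfolding inner_on_add_right inner_on_scale_right by (simp add: assms(1))
  then show ?case .
qed

text \<open>Gram-Schmidt, one generator at a time: \<open>y\<close> is the part of the new generator
  \<open>v\<close> that is orthogonal to the previous ones.\<close>

lemma orthogonal_decomposition_finite:
  assumes J: "finite J" and "finite B"
  shows "\<exists>s\<in>cfun.span B. \<forall>b\<in>B. inner_on J (c - s) b = 0"
  using assms(2)
proof (induction B arbitrary: c rule: finite_induct)
  case (insert v B)
  obtain s where s: "s \<in> cfun.span B" "\<And>b. b \<in> B \<Longrightarrow> inner_on J (c - s) b = 0"
    using insert.IH by blast
  obtain s' where s': "s' \<in> cfun.span B" "\<And>b. b \<in> B \<Longrightarrow> inner_on J (v - s') b = 0"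
    using insert.IH by blast
  define y where "y = v - s'"
  \<comment> \<open>If \<open>y\<close> vanishes on \<open>J\<close>, division by zero gives 0,
    which is a correct coefficient since every product with \<open>y\<close> is then 0.\<close>
  define k where "k = inner_on J (c - s) y / inner_on J y y"
  have y: "inner_on J y b = 0" if "b \<in> cfun.span B" for b
    using orthogonal_to_span[OF s'(2) that] by (simp add: y_def)
  have span: "cfun.span B \<subseteq> cfun.span (insert v B)" by (rule cfun.span_mono) auto
  then have "y \<in> cfun.span (insert v B)"
    unfolding y_def using s'(1) by (auto intro!: cfun.span_diff intro: cfun.span_base)
  then have "s + cfun_scale k y \<in> cfun.span (insert v B)"
    using span s(1) by (intro cfun.span_add cfun.span_scale) auto
  moreover have "inner_on J (c - (s + cfun_scale k y)) b = 0" if "b \<in> insert v B" for b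
  proof -
    have *: "inner_on J (c - (s + cfun_scale k y)) d = inner_on J (c - s) d - k * inner_on J y d" for d
      by (simp add: inner_on_diff inner_on_add inner_on_scale)
    have B: "inner_on J (c - (s + cfun_scale k y)) d = 0" if "d \<in> cfun.span B" for d
      using that y orthogonal_to_span[OF s(2) that] by (simp add: *)
    have "inner_on J (c - s) y = 0" if "inner_on J y y = 0"
      using inner_on_self_eq_0[OF J that] by (simp add: inner_on_def)
    then have "inner_on J (c - (s + cfun_scale k y)) y = 0"
      by (subst *) (cases "inner_on J y y = 0"; simp add: k_def)
    moreover have "v = y + s'" by (simp add: y_def)
    ultimately have "inner_on J (c - (s + cfun_scale k y)) v = 0"
      using B[OF s'(1)] by (simp add: inner_on_add_right)
    then show ?thesis using that B cfun.span_base by auto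
  qed
  ultimately show ?case by blast
qed (auto simp: cfun.span_empty)

text \<open>The support condition places \<open>S\<close> in the span of finitely many unit vectors,
  so it has a finite basis.\<close>

lemma orthogonal_decomposition:
  assumes J: "finite J" and S: "cfun.subspace S" and supp: "\<And>c \<alpha>. c \<in> S \<Longrightarrow> \<alpha> \<notin> J \<Longrightarrow> c \<alpha> = 0"
  obtains s where "s \<in> S" "\<And>d. d \<in> S \<Longrightarrow> inner_on J (c - s) d = 0"
proof -
  obtain B where B: "B \<subseteq> S" "cfun.independent B" "S \<subseteq> cfun.span B"
    by (rule cfun.maximal_independent_subset)
  define E where "E = (\<lambda>\<alpha> \<beta>. if \<beta> = \<alpha> then 1 else 0 :: complex) ` J"
  have "c \<in> cfun.span E" if "c \<in> S" for c
  proof -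
    have "c = (\<Sum>\<alpha>\<in>J. cfun_scale (c \<alpha>) (\<lambda>\<beta>. if \<beta> = \<alpha> then 1 else 0))"
      using supp[OF that] J by (auto simp: fun_eq_iff sum_fun_apply fun_scale_def if_distrib cong: if_cong)
    also have "\<dots> \<in> cfun.span E"
      by (intro cfun.span_sum cfun.span_scale cfun.span_base) (auto simp: E_def)
    finally show ?thesis .
  qed
  moreover have "finite E" using J by (simp add: E_def)
  ultimately have "finite B"
    using cfun.independent_span_bound[of E B] B(1,2) by blast
  then obtain s where s: "s \<in> cfun.span B" "\<forall>b\<in>B. inner_on J (c - s) b = 0"
    using orthogonal_decomposition_finite[OF J] by blast
  have "s \<in> S" using s(1) B(1) S cfun.span_minimal by blast
  moreover have "inner_on J (c - s) d = 0" if "d \<in> S" for d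
    using orthogonal_to_span[of B J "c - s" d] s(2) B(3) that by blast
  ultimately show thesis using that by blast
qed

text \<open>Complete reducibility without integration: a quotient of a unitary space on which the
  operators are closed under taking adjoints.\<close>

lemma invariant_complement:
  fixes F :: "'j \<Rightarrow> 'a \<Rightarrow> complex" and \<rho> :: "'g \<Rightarrow> ('a \<Rightarrow> complex) \<Rightarrow> 'a \<Rightarrow> complex"
  assumes J: "finite J"
    and add: "\<And>g x y. g \<in> G \<Longrightarrow> \<rho> g (x + y) = \<rho> g x + \<rho> g y"
    and scale: "\<And>g k x. g \<in> G \<Longrightarrow> \<rho> g (cfun_scale k x) = cfun_scale k (\<rho> g x)"
    and R: "\<And>g \<alpha>. g \<in> G \<Longrightarrow> \<alpha> \<in> J \<Longrightarrow> \<rho> g (F \<alpha>) = (\<Sum>\<beta>\<in>J. cfun_scale (R g \<beta> \<alpha>) (F \<beta>))"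
    and adjoint: "\<And>g. g \<in> G \<Longrightarrow> \<exists>h\<in>G. \<forall>\<alpha>\<in>J. \<forall>\<beta>\<in>J. R h \<beta> \<alpha> = cnj (R g \<alpha> \<beta>)"
    and N: "cfun.subspace N" and N_inv: "\<And>g x. g \<in> G \<Longrightarrow> x \<in> N \<Longrightarrow> \<rho> g x \<in> N"
  obtains C where "cfun.subspace C" "\<And>g x. g \<in> G \<Longrightarrow> x \<in> C \<Longrightarrow> \<rho> g x \<in> C"
    "\<And>x. x \<in> N \<Longrightarrow> x \<in> C \<Longrightarrow> x = 0" "\<And>x. x \<in> cfun.span (F ` J) \<Longrightarrow> \<exists>y\<in>N. \<exists>z\<in>C. x = y + z"
proof -
  define comb where "comb c = (\<Sum>\<alpha>\<in>J. cfun_scale (c \<alpha>) (F \<alpha>))" for c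
  have comb_add: "comb (c + d) = comb c + comb d" for c d
    by (simp add: comb_def cfun.scale_left_distrib sum.distrib)
  have comb_scale: "comb (cfun_scale k c) = cfun_scale k (comb c)" for k c
    by (simp add: comb_def fun_scale_apply cfun.scale_sum_right)
  have comb_cong: "comb c = comb d" if "\<And>\<alpha>. \<alpha> \<in> J \<Longrightarrow> c \<alpha> = d \<alpha>" for c d
    using that by (simp add: comb_def)
  have comb_0: "comb 0 = 0" by (simp add: comb_def)
  define act where "act g c = (\<lambda>\<beta>. \<Sum>\<alpha>\<in>J. R g \<beta> \<alpha> * c \<alpha>)" for g c
  have \<rho>_comb: "\<rho> g (comb c) = comb (act g c)" if g: "g \<in> G" for g c
  proof -
    have "\<rho> g 0 = 0" using scale[OF g, of 0 0] by simp
    then have \<rho>_sum: "\<rho> g (\<Sum>i\<in>I. x i) = (\<Sum>i\<in>I. \<rho> g (x i))" for I :: "'j set" and x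
      by (induction I rule: infinite_finite_induct) (auto simp: add[OF g])
    have "\<rho> g (comb c) = (\<Sum>\<alpha>\<in>J. \<Sum>\<beta>\<in>J. cfun_scale (R g \<beta> \<alpha> * c \<alpha>) (F \<beta>))"
      by (simp add: comb_def \<rho>_sum scale[OF g] R[OF g] cfun.scale_sum_right mult.commute)
    also have "\<dots> = comb (act g c)"
      unfolding comb_def act_def cfun.scale_sum_left by (rule sum.swap)
    finally show ?thesis .
  qed
  \<comment> \<open>The \<open>F \<alpha>\<close> may be linearly dependent, so the work takes place
    on coefficient vectors. \<open>S\<close> is the preimage of \<open>N\<close> and contains all
    relations supported on \<open>J\<close>; \<open>C\<close> is the image of its orthogonal
    complement.\<close>
  define S where "S = {c. (\<forall>\<alpha>. \<alpha> \<notin> J \<longrightarrow> c \<alpha> = 0) \<and> comb c \<in> N}"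
  define C where "C = comb ` {c. \<forall>d\<in>S. inner_on J c d = 0}"
  have restrict: "(\<lambda>\<alpha>. if \<alpha> \<in> J then c \<alpha> else 0) \<in> S" if "comb c \<in> N" for c
    using that comb_cong[of c "\<lambda>\<alpha>. if \<alpha> \<in> J then c \<alpha> else 0"] by (simp add: S_def)
  have S: "cfun.subspace S"
    using N by (auto simp: cfun.subspace_def S_def comb_add comb_scale comb_0 fun_scale_apply)
  show thesis
  proof
    have "0 \<in> C" using comb_0 by (auto simp: C_def inner_on_zero intro!: image_eqI[of _ _ 0])
    moreover have "x + y \<in> C" if xy: "x \<in> C" "y \<in> C" for x y
    proof -
      obtain c d where "x = comb c" "y = comb d" "\<forall>s\<in>S. inner_on J c s = 0" "\<forall>s\<in>S. inner_on J d s = 0"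
        using xy unfolding C_def by blast
      then show ?thesis by (auto simp: C_def comb_add inner_on_add intro!: image_eqI[of _ _ "c + d"])
    qed
    moreover have "cfun_scale k x \<in> C" if x: "x \<in> C" for k x
    proof -
      obtain c where "x = comb c" "\<forall>s\<in>S. inner_on J c s = 0"
        using x unfolding C_def by blast
      then show ?thesis by (auto simp: C_def comb_scale inner_on_scale intro!: image_eqI[of _ _ "cfun_scale k c"])
    qed
    ultimately show "cfun.subspace C" by (auto simp: cfun.subspace_def)
  next
    fix g x assume g: "g \<in> G" and "x \<in> C"
    then obtain c where c: "x = comb c" "\<And>s. s \<in> S \<Longrightarrow> inner_on J c s = 0" unfolding C_def by blast
    obtain h where h: "h \<in> G" "\<And>\<alpha> \<beta>. \<alpha> \<in> J \<Longrightarrow> \<beta> \<in> J \<Longrightarrow> R h \<beta> \<alpha> = cnj (R g \<alpha> \<beta>)"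
      using adjoint[OF g] by blast
    \<comment> \<open>Moving \<open>act g\<close> to the other side turns it into
      \<open>act h\<close>, which maps \<open>S\<close> into itself up to entries outside
      \<open>J\<close>.\<close>
    have "inner_on J (act g c) s = 0" if "s \<in> S" for s
    proof -
      have "inner_on J (act g c) s = (\<Sum>\<beta>\<in>J. \<Sum>\<alpha>\<in>J. c \<alpha> * cnj (R h \<alpha> \<beta> * s \<beta>))"
        by (simp add: inner_on_def act_def sum_distrib_left sum_distrib_right h(2) mult_ac)
      also have "\<dots> = (\<Sum>\<alpha>\<in>J. \<Sum>\<beta>\<in>J. c \<alpha> * cnj (R h \<alpha> \<beta> * s \<beta>))" by (rule sum.swap)
      also have "\<dots> = inner_on J c (\<lambda>\<alpha>. if \<alpha> \<in> J then act h s \<alpha> else 0)"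
        by (simp add: inner_on_def act_def sum_distrib_left cong: sum.cong)
      also have "\<dots> = 0"
        using that N_inv[OF h(1), of "comb s"] \<rho>_comb[OF h(1), of s] by (intro c(2) restrict) (auto simp: S_def)
      finally show ?thesis .
    qed
    then show "\<rho> g x \<in> C" using c(1) \<rho>_comb[OF g] by (auto simp: C_def)
  next
    fix x assume x: "x \<in> N" "x \<in> C"
    then obtain c where c: "x = comb c" "\<And>s. s \<in> S \<Longrightarrow> inner_on J c s = 0" unfolding C_def by blast
    \<comment> \<open>The restriction of \<open>c\<close> to \<open>J\<close> still represents
      \<open>x\<close>, hence lies in \<open>S\<close>, so \<open>c\<close> is orthogonal to
      itself.\<close>
    have "inner_on J c c = inner_on J c (\<lambda>\<alpha>. if \<alpha> \<in> J then c \<alpha> else 0)"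
      by (simp add: inner_on_def)
    also have "\<dots> = 0" using restrict x(1) c by blast
    finally have "c \<alpha> = 0" if "\<alpha> \<in> J" for \<alpha> using inner_on_self_eq_0[OF J] that by blast
    then show "x = 0" using comb_cong[of c 0] c(1) comb_0 by simp
  next
    fix x assume "x \<in> cfun.span (F ` J)"
    then have "\<exists>c. x = comb c"
    proof (induction rule: cfun.span_induct_alt)
      case base
      then show ?case using comb_0 by metis
    next
      case (step k x y)
      then obtain c \<alpha> where "y = comb c" "\<alpha> \<in> J" "x = F \<alpha>" by auto
      moreover have "comb (\<lambda>\<beta>. if \<beta> = \<alpha> then 1 else 0) = F \<alpha>" if "\<alpha> \<in> J"
      proof -
        have "comb (\<lambda>\<beta>. if \<beta> = \<alpha> then 1 else 0) = (\<Sum>\<beta>\<in>J. if \<beta> = \<alpha> then F \<beta> else 0)"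
          unfolding comb_def by (rule sum.cong) auto
        then show ?thesis using that J by simp
      qed
      ultimately have "cfun_scale k x + y = comb (cfun_scale k (\<lambda>\<beta>. if \<beta> = \<alpha> then 1 else 0) + c)"
        by (simp add: comb_add comb_scale)
      then show ?case by blast
    qed
    then obtain c where c: "x = comb c" by blast
    obtain s where s: "s \<in> S" "\<And>d. d \<in> S \<Longrightarrow> inner_on J (c - s) d = 0"
      using orthogonal_decomposition[OF J S] by (auto simp: S_def)
    have "x = comb s + comb (c - s)" using c comb_add[of s "c - s"] by simp
    then show "\<exists>y\<in>N. \<exists>z\<in>C. x = y + z"
      using s by (auto simp: S_def C_def)
  qed
qed

section \<open>The action on polynomials in a basis\<close>

lemma prod_blocks: "(\<Prod>i<n. \<Prod>j<4. h (i * 4 + j)) = (\<Prod>k<n * 4. h k)"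
  for h :: "nat \<Rightarrow> complex"
proof -
  have "(\<Prod>j<4. h (i * 4 + j)) = prod h {i * 4..<i * 4 + 4}" for i
    using prod.atLeastLessThan_shift_0[of h "i * 4" "i * 4 + 4"] by (simp add: lessThan_atLeast0)
  then show ?thesis by (simp add: prod.nat_group)
qed

lemma subspace_hom_polys: "cfun.subspace (hom_polys s A d)"
  unfolding hom_polys_def by (rule cfun.subspace_span)

lemma prod_in_hom_polys:
  assumes "\<And>i. i < d \<Longrightarrow> Vector_Spaces.linear s (*) (l i)"
  shows "(\<lambda>x. if x \<in> A then \<Prod>i<d. l i x else 0) \<in> hom_polys s A d"
  unfolding hom_polys_def using assms by (intro cfun.span_base) blast

section \<open>The group GL(V) acting on quartic forms and on functions of them\<close>

context complex_vector_space
begin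

lemma GL_iff: "g \<in> GL (*s) \<longleftrightarrow>
    (\<forall>x y. g (x + y) = g x + g y) \<and> (\<forall>c x. g (c *s x) = c *s g x) \<and> bij g"
  using vector_space_axioms by (simp add: GL_def Vector_Spaces.linear_iff)

lemma GL_add: "g \<in> GL (*s) \<Longrightarrow> g (x + y) = g x + g y"
  and GL_scale: "g \<in> GL (*s) \<Longrightarrow> g (c *s x) = c *s g x"
  and GL_bij: "g \<in> GL (*s) \<Longrightarrow> bij g"
  by (auto simp: GL_iff)

lemma GL_sum: "g \<in> GL (*s) \<Longrightarrow> g (\<Sum>i\<in>I. x i) = (\<Sum>i\<in>I. g (x i))"
  by (induction I rule: infinite_finite_induct) (use GL_scale[of g 0 0] in \<open>auto simp: GL_add\<close>)

lemma GL_id: "id \<in> GL (*s)"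
  by (simp add: GL_iff)

lemma GL_comp: "g \<in> GL (*s) \<Longrightarrow> h \<in> GL (*s) \<Longrightarrow> g \<circ> h \<in> GL (*s)"
  by (auto simp: GL_iff intro: bij_comp)

lemma GL_inv:
  assumes g: "g \<in> GL (*s)"
  shows "inv g \<in> GL (*s)"
proof -
  note inj = bij_is_inj[OF GL_bij[OF g]]
  note [simp] = surj_f_inv_f[OF bij_is_surj[OF GL_bij[OF g]]]
  have "inv g (x + y) = inv g x + inv g y" for x y
    by (rule injD[OF inj]) (simp add: GL_add[OF g])
  moreover have "inv g (c *s x) = c *s inv g x" for c x
    by (rule injD[OF inj]) (simp add: GL_scale[OF g])
  ultimately show ?thesis
    unfolding GL_iff using bij_imp_bij_inv[OF GL_bij[OF g]] by blast
qed

text \<open>Precomposition with \<open>inv g\<close> is undone by precomposition with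
  \<open>g\<close>, so the second application of \<open>fun_act\<close> removes the inverse.\<close>

lemma fun_act_twice:
  fixes F :: "('v \<Rightarrow> complex) \<Rightarrow> complex"
  assumes g: "g \<in> GL (*s)"
  shows "fun_act (fun_act g) F f = F (f \<circ> g)"
proof -
  have "inv (fun_act g) f = f \<circ> g" for f :: "'v \<Rightarrow> complex"
  proof (rule fun_cong[OF inv_equality])
    note b = GL_bij[OF g]
    show "fun_act g f \<circ> g = f" for f :: "'v \<Rightarrow> complex"
      using bij_is_inj[OF b] by (auto simp: fun_act_def fun_eq_iff)
    show "fun_act g (f \<circ> g) = f" for f :: "'v \<Rightarrow> complex"
      using bij_is_surj[OF b] by (auto simp: fun_act_def fun_eq_iff surj_f_inv_f)
  qed
  then show ?thesis by (simp add: fun_act_def)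
qed

lemma sym_dual_comp:
  assumes g: "g \<in> GL (*s)" and f: "f \<in> sym_dual (*s) 4"
  shows "f \<circ> g \<in> sym_dual (*s) 4"
  using f unfolding hom_polys_def[of _ _ 4]
proof (induction rule: cfun.span_induct_alt)
  case base
  have "(0 :: 'v \<Rightarrow> complex) \<circ> g = 0" by (simp add: fun_eq_iff)
  then show ?case by (metis cfun.span_zero)
next
  case (step c x y)
  then obtain l where l: "\<And>i. i < (4::nat) \<Longrightarrow> lin (l i)" and x: "x = (\<lambda>v. \<Prod>i<4. l i v)"
    by (auto simp: linear_iff_lin)
  have "lin (\<lambda>v. l i (g v))" if "i < 4" for i
    using l[OF that] by (simp add: lin_def GL_add[OF g] GL_scale[OF g])
  then have "x \<circ> g \<in> sym_dual (*s) 4"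
    using prod_in_hom_polys[of 4 "(*s)" "\<lambda>i v. l i (g v)" UNIV] unfolding linear_iff_lin x
    by (simp add: comp_def)
  then have "cfun_scale c (x \<circ> g) + (y \<circ> g) \<in> sym_dual (*s) 4"
    using step(2) unfolding hom_polys_def[of _ _ 4] by (intro cfun.span_add cfun.span_scale)
  also have "cfun_scale c (x \<circ> g) + (y \<circ> g) = (cfun_scale c x + y) \<circ> g"
    by (simp add: fun_eq_iff fun_scale_apply)
  finally show ?case unfolding hom_polys_def[of _ _ 4] .
qed

text \<open>Functions on quartic forms are cut off to 0 outside \<open>sym_dual\<close>; the
  equivalence shows that the action respects the cutoff.\<close>

lemma sym_dual_comp_iff:
  assumes g: "g \<in> GL (*s)"
  shows "f \<circ> g \<in> sym_dual (*s) 4 \<longleftrightarrow> f \<in> sym_dual (*s) 4"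
proof
  assume "f \<circ> g \<in> sym_dual (*s) 4"
  then have "(f \<circ> g) \<circ> inv g \<in> sym_dual (*s) 4" by (rule sym_dual_comp[OF GL_inv[OF g]])
  then show "f \<in> sym_dual (*s) 4"
    using surj_f_inv_f[OF bij_is_surj[OF GL_bij[OF g]]] by (simp add: comp_def)
qed (rule sym_dual_comp[OF g])

lemma pol_GL: "g \<in> GL (*s) \<Longrightarrow> pol (f \<circ> g) a b c d = pol f (g a) (g b) (g c) (g d)"
  using pol_comp[of g f] by (simp add: GL_add comp_def)

definition hw_vector :: "nat \<Rightarrow> (nat \<Rightarrow> 'v) \<Rightarrow> ('v \<Rightarrow> complex) \<Rightarrow> complex" where
  "hw_vector n b f = (if f \<in> sym_dual (*s) 4 then hw_form n (pol f) b b b b b b else 0)"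

text \<open>Equivariance: acting on the function amounts to moving the tuple \<open>b\<close>. Facts
  proved for arbitrary \<open>b\<close> therefore hold on the whole orbit.\<close>

lemma fun_act_hw_vector:
  assumes g: "g \<in> GL (*s)"
  shows "fun_act (fun_act g) (hw_vector n b) = hw_vector n (g \<circ> b)"
proof -
  have pol: "pol (f \<circ> g) = (\<lambda>a b c d. pol f (g a) (g b) (g c) (g d))" for f
    by (intro ext pol_GL[OF g])
  show ?thesis
    by (simp add: fun_eq_iff fun_act_twice[OF g] hw_vector_def sym_dual_comp_iff[OF g] hw_form_comp pol)
qed

end

section \<open>Coordinates, monomials and matrix entries in an ordered basis\<close>

locale complex_basis = complex_vector_space scale
  for scale :: "complex \<Rightarrow> 'v::ab_group_add \<Rightarrow> 'v" (infixr "*s" 75) +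
  fixes bs :: "'v list"
  assumes bs: "ordered_basis (*s) bs"
begin

definition coord :: "nat \<Rightarrow> 'v \<Rightarrow> complex" where
  "coord i v = representation (set bs) v (bs ! i)"

lemma distinct_bs: "distinct bs"
  and independent_bs: "independent (set bs)"
  and span_bs: "v \<in> span (set bs)"
  using bs by (auto simp: ordered_basis_def)

lemma lin_coord: "lin (coord i)"
  by (simp add: lin_def coord_def representation_add[OF independent_bs span_bs span_bs]
      representation_scale[OF independent_bs span_bs])

lemma coord_nth: "i < length bs \<Longrightarrow> j < length bs \<Longrightarrow> coord i (bs ! j) = (if i = j then 1 else 0)"
  by (simp add: coord_def representation_basis[OF independent_bs] nth_eq_iff_index_eq[OF distinct_bs])

lemma sum_coord: "(\<Sum>i<length bs. coord i v *s (bs ! i)) = v"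
proof -
  have "v = (\<Sum>b\<in>set bs. representation (set bs) v b *s b)"
    by (rule sum_representation_eq[symmetric, OF independent_bs span_bs]) auto
  also have "\<dots> = (\<Sum>i<length bs. coord i v *s (bs ! i))"
    unfolding coord_def
    by (rule sum.reindex_bij_betw[symmetric, OF bij_betw_nth[OF distinct_bs refl refl]])
  finally show ?thesis by simp
qed

fun slot :: "nat \<times> nat \<times> nat \<times> nat \<Rightarrow> nat \<Rightarrow> nat" where
  "slot (a, b, c, d) j = (if j = 0 then a else if j = 1 then b else if j = 2 then c else d)"

text \<open>A letter lists the basis vectors in the four slots of one polarized coefficient \<open>pol f\<close>; a word
  lists the coefficients in a monomial.\<close>

definition letters :: "(nat \<times> nat \<times> nat \<times> nat) set" where
  "letters = {..<length bs} \<times> {..<length bs} \<times> {..<length bs} \<times> {..<length bs}"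

definition pol_letter :: "('v \<Rightarrow> complex) \<Rightarrow> nat \<times> nat \<times> nat \<times> nat \<Rightarrow> complex" where
  "pol_letter f x = pol f (bs ! slot x 0) (bs ! slot x 1) (bs ! slot x 2) (bs ! slot x 3)"

definition mon :: "nat \<Rightarrow> (nat \<Rightarrow> nat \<times> nat \<times> nat \<times> nat) \<Rightarrow> ('v \<Rightarrow> complex) \<Rightarrow> complex" where
  "mon d \<alpha> f = (if f \<in> sym_dual (*s) 4 then \<Prod>i<d. pol_letter f (\<alpha> i) else 0)"

definition words :: "nat \<Rightarrow> (nat \<Rightarrow> nat \<times> nat \<times> nat \<times> nat) set" where
  "words d = PiE {..<d} (\<lambda>_. letters)"

text \<open>Matrix entries of the fourth tensor power of \<open>g\<close>; \<open>word_mat d\<close>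
  gives those of the tensor power of degree \<open>4 d\<close>. Words are ordered, so different
  words may define the same monomial, but in exchange the matrices have evident adjoints.\<close>

definition letter_mat :: "('v \<Rightarrow> 'v) \<Rightarrow> nat \<times> nat \<times> nat \<times> nat \<Rightarrow> nat \<times> nat \<times> nat \<times> nat \<Rightarrow> complex" where
  "letter_mat g x y = (\<Prod>j<4. coord (slot x j) (g (bs ! slot y j)))"

definition word_mat :: "nat \<Rightarrow> ('v \<Rightarrow> 'v) \<Rightarrow> (nat \<Rightarrow> nat \<times> nat \<times> nat \<times> nat) \<Rightarrow> (nat \<Rightarrow> nat \<times> nat \<times> nat \<times> nat) \<Rightarrow> complex" where
  "word_mat d g \<beta> \<alpha> = (\<Prod>i<d. letter_mat g (\<beta> i) (\<alpha> i))"

lemma finite_letters: "finite letters" and finite_words: "finite (words d)"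
  by (auto simp: letters_def words_def intro!: finite_PiE)

lemma slot_less: "x \<in> letters \<Longrightarrow> slot x j < length bs"
  by (cases x) (auto simp: letters_def)

lemma mon_in_hom_polys: "mon d \<alpha> \<in> hom_polys cfun_scale (sym_dual (*s) 4) d"
proof -
  have "Vector_Spaces.linear cfun_scale (*) (\<lambda>f. pol_letter f x)" for x
    unfolding Vector_Spaces.linear_iff pol_letter_def
    using cfun.vector_space_axioms vector_space_complex by (simp add: pol_plus pol_scale)
  then show ?thesis
    unfolding mon_def[abs_def] by (rule prod_in_hom_polys)
qed

lemma quadlin_expand:
  assumes Q: "quadlin Q"
  shows "Q (\<Sum>i<n. p i *s e i) (\<Sum>i<n. q i *s e i) (\<Sum>i<n. s i *s e i) (\<Sum>i<n. t i *s e i) =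
    (\<Sum>(a, b, c, d)\<in>{..<n} \<times> {..<n} \<times> {..<n} \<times> {..<n}. p a * q b * s c * t d * Q (e a) (e b) (e c) (e d))"
proof -
  have l: "lin (\<lambda>v. Q v x y z)" "lin (\<lambda>v. Q x v y z)" "lin (\<lambda>v. Q x y v z)" "lin (\<lambda>v. Q x y z v)" for x y z
    using Q by (auto simp: quadlin_def)
  show ?thesis
    unfolding sum.cartesian_product[symmetric]
    unfolding l(1)[THEN lin_sum] l(1)[THEN lin_scale] unfolding l(2)[THEN lin_sum] l(2)[THEN lin_scale]
    unfolding l(3)[THEN lin_sum] l(3)[THEN lin_scale] unfolding l(4)[THEN lin_sum] l(4)[THEN lin_scale]
    by (simp add: sum_distrib_left mult.assoc)
qed

lemma pol_letter_comp:
  assumes g: "g \<in> GL (*s)" and f: "f \<in> sym_dual (*s) 4"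
  shows "pol_letter (f \<circ> g) y = (\<Sum>x\<in>letters. letter_mat g x y * pol_letter f x)"
proof -
  have "pol_letter (f \<circ> g) y = pol f (\<Sum>i<length bs. coord i (g (bs ! slot y 0)) *s (bs ! i))
      (\<Sum>i<length bs. coord i (g (bs ! slot y 1)) *s (bs ! i))
      (\<Sum>i<length bs. coord i (g (bs ! slot y 2)) *s (bs ! i))
      (\<Sum>i<length bs. coord i (g (bs ! slot y 3)) *s (bs ! i))"
    unfolding sum_coord by (simp add: pol_letter_def pol_GL[OF g])
  also have "\<dots> = (\<Sum>x\<in>letters. letter_mat g x y * pol_letter f x)"
    unfolding quadlin_expand[OF quadlin_pol[OF f]] letters_def
    by (rule sum.cong) (auto simp: letter_mat_def prod_lessThan_4 pol_letter_def)
  finally show ?thesis .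
qed

lemma fun_act_mon:
  assumes g: "g \<in> GL (*s)"
  shows "fun_act (fun_act g) (mon d \<alpha>) = (\<Sum>\<beta>\<in>words d. cfun_scale (word_mat d g \<beta> \<alpha>) (mon d \<beta>))"
proof
  fix f
  show "fun_act (fun_act g) (mon d \<alpha>) f = (\<Sum>\<beta>\<in>words d. cfun_scale (word_mat d g \<beta> \<alpha>) (mon d \<beta>)) f"
  proof (cases "f \<in> sym_dual (*s) 4")
    case True
    have "(\<Prod>i<d. \<Sum>x\<in>letters. letter_mat g x (\<alpha> i) * pol_letter f x) =
        (\<Sum>\<beta>\<in>words d. \<Prod>i<d. letter_mat g (\<beta> i) (\<alpha> i) * pol_letter f (\<beta> i))"
      unfolding words_def by (rule prod_sum_PiE) (auto simp: finite_letters)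
    then show ?thesis
      using True by (simp add: fun_act_twice[OF g] mon_def sym_dual_comp_iff[OF g] sum_fun_apply
          fun_scale_apply pol_letter_comp[OF g True] word_mat_def prod.distrib)
  qed (simp add: fun_act_twice[OF g] mon_def sym_dual_comp_iff[OF g] sum_fun_apply fun_scale_apply)
qed

text \<open>Conjugate transpose of the matrix of \<open>g\<close> in the basis
  \<open>bs\<close>.\<close>

definition adjoint :: "('v \<Rightarrow> 'v) \<Rightarrow> 'v \<Rightarrow> 'v" where
  "adjoint g v = (\<Sum>i<length bs. (\<Sum>j<length bs. cnj (coord j (g (bs ! i))) * coord j v) *s (bs ! i))"

lemma coord_sum: "i < length bs \<Longrightarrow> coord i (\<Sum>k<length bs. c k *s (bs ! k)) = c i"
  by (simp add: lin_sum[OF lin_coord] lin_scale[OF lin_coord] coord_nth if_distrib cong: if_cong)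

lemma coord_adjoint:
  "i < length bs \<Longrightarrow> coord i (adjoint g v) = (\<Sum>j<length bs. cnj (coord j (g (bs ! i))) * coord j v)"
  unfolding adjoint_def by (rule coord_sum)

lemma coord_adjoint_nth:
  "i < length bs \<Longrightarrow> j < length bs \<Longrightarrow> coord i (adjoint g (bs ! j)) = cnj (coord j (g (bs ! i)))"
  by (simp add: coord_adjoint coord_nth if_distrib cong: if_cong)

text \<open>Conjugate transposition reverses products, so \<open>h \<circ> g = id\<close> becomes
  \<open>adjoint g \<circ> adjoint h = id\<close>. This yields the bijectivity of
  \<open>adjoint g\<close>.\<close>

lemma adjoint_comp_inverse:
  assumes g: "g \<in> GL (*s)" and h: "h \<in> GL (*s)" and hg: "\<And>v. h (g v) = v"
  shows "adjoint g (adjoint h v) = v"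
proof -
  let ?n = "length bs"
  have "coord i (adjoint g (adjoint h v)) = coord i v" if i: "i < ?n" for i
  proof -
    have "coord i (adjoint g (adjoint h v)) =
        (\<Sum>j<?n. \<Sum>k<?n. cnj (coord j (g (bs ! i)) * coord k (h (bs ! j))) * coord k v)"
      by (simp add: coord_adjoint[OF i] coord_adjoint sum_distrib_left mult.assoc)
    also have "\<dots> = (\<Sum>k<?n. cnj (\<Sum>j<?n. coord j (g (bs ! i)) * coord k (h (bs ! j))) * coord k v)"
      by (subst sum.swap) (simp add: sum_distrib_right)
    also have "\<dots> = (\<Sum>k<?n. cnj (coord k (h (\<Sum>j<?n. coord j (g (bs ! i)) *s (bs ! j)))) * coord k v)"
      by (simp add: GL_sum[OF h] GL_scale[OF h] lin_sum[OF lin_coord] lin_scale[OF lin_coord])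
    also have "\<dots> = coord i v"
      using i by (simp add: sum_coord hg coord_nth if_distrib[of cnj] if_distrib[of "\<lambda>c. c * _"] cong: if_cong)
    finally show ?thesis .
  qed
  then have "(\<Sum>i<?n. coord i (adjoint g (adjoint h v)) *s (bs ! i)) = (\<Sum>i<?n. coord i v *s (bs ! i))"
    by simp
  then show ?thesis unfolding sum_coord .
qed

lemma adjoint_GL:
  assumes g: "g \<in> GL (*s)"
  shows "adjoint g \<in> GL (*s)"
  unfolding GL_iff
proof (intro conjI allI)
  have "\<And>v. inv g (g v) = v" "\<And>v. g (inv g v) = v"
    using GL_bij[OF g] by (simp_all add: bij_is_inj bij_is_surj surj_f_inv_f)
  then have "adjoint g (adjoint (inv g) v) = v" "adjoint (inv g) (adjoint g v) = v" for v
    using adjoint_comp_inverse[OF g GL_inv[OF g]] adjoint_comp_inverse[OF GL_inv[OF g] g] by auto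
  then show "bij (adjoint g)" by (metis bijI')
  show "adjoint g (x + y) = adjoint g x + adjoint g y" for x y
    by (simp add: adjoint_def lin_add[OF lin_coord] distrib_left sum.distrib scale_left_distrib)
  show "adjoint g (c *s x) = c *s adjoint g x" for c x
    by (simp add: adjoint_def lin_scale[OF lin_coord] scale_sum_right sum_distrib_left mult_ac)
qed

lemma word_mat_adjoint:
  assumes "\<alpha> \<in> words d" "\<beta> \<in> words d"
  shows "word_mat d (adjoint g) \<beta> \<alpha> = cnj (word_mat d g \<alpha> \<beta>)"
proof -
  have "slot (\<alpha> i) j < length bs" "slot (\<beta> i) j < length bs" if "i < d" for i j
    using assms that by (auto simp: words_def intro!: slot_less)
  then show ?thesis by (simp add: word_mat_def letter_mat_def coord_adjoint_nth)
qed

lemma word_mat_polynomial: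
  "(\<lambda>h. if Vector_Spaces.linear (*s) (*s) h then word_mat d h \<beta> \<alpha> else 0)
     \<in> hom_polys (fun_scale (*s)) {h. Vector_Spaces.linear (*s) (*s) h} (d * 4)"
proof -
  \<comment> \<open>The \<open>4 d\<close> matrix entries in one sequence: \<open>k div 4\<close> is
    the letter and \<open>k mod 4\<close> the slot. Each entry is linear in
    \<open>h\<close>.\<close>
  define l where "l k h = coord (slot (\<beta> (k div 4)) (k mod 4)) (h (bs ! slot (\<alpha> (k div 4)) (k mod 4)))" for k and h :: "'v \<Rightarrow> 'v"
  have vs: "vector_space (fun_scale (*s) :: complex \<Rightarrow> ('v \<Rightarrow> 'v) \<Rightarrow> 'v \<Rightarrow> 'v)"
    by unfold_locales (auto simp: fun_scale_def fun_eq_iff scale_right_distrib scale_left_distrib)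
  have "Vector_Spaces.linear (fun_scale (*s)) (*) (l k)" for k
    unfolding Vector_Spaces.linear_iff l_def
    using vs vector_space_complex by (simp add: fun_scale_apply lin_add[OF lin_coord] lin_scale[OF lin_coord])
  moreover have eq: "word_mat d h \<beta> \<alpha> = (\<Prod>k<d * 4. l k h)" for h
    unfolding prod_blocks[symmetric] by (simp add: word_mat_def letter_mat_def l_def)
  ultimately show ?thesis
    unfolding eq using prod_in_hom_polys[of "d * 4" "fun_scale (*s)" l "{h. Vector_Spaces.linear (*s) (*s) h}"] by simp
qed

lemma alt_in_span:
  assumes "cfun.subspace S"
    and "\<And>\<sigma>. \<sigma> permutes {..<n} \<Longrightarrow> (\<lambda>f. if f \<in> A then T f (b \<circ> \<sigma>) else 0) \<in> S"
  shows "(\<lambda>f. if f \<in> A then alt n (T f) b else 0) \<in> S"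
proof -
  have "(\<lambda>f. if f \<in> A then alt n (T f) b else 0) =
    (\<Sum>\<sigma> | \<sigma> permutes {..<n}. cfun_scale (of_int (sign \<sigma>)) (\<lambda>f. if f \<in> A then T f (b \<circ> \<sigma>) else 0))"
    by (auto simp: fun_eq_iff sum_fun_apply fun_scale_apply alt_def)
  then show ?thesis
    using assms by (auto intro!: cfun.subspace_sum cfun.subspace_scale)
qed

text \<open>Expanding the six antisymmetrizations leaves signed products of \<open>n + 1\<close>
  polarized coefficients, each a single monomial.\<close>

lemma hw_vector_in_span:
  assumes n: "2 \<le> n" "n \<le> length bs"
  shows "hw_vector n ((!) bs) \<in> cfun.span (mon (n + 1) ` words (n + 1))"
  unfolding hw_vector_def[abs_def] hw_form_def brack_def
proof (intro alt_in_span cfun.subspace_span)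
  fix \<tau>1 \<tau>2 \<sigma>1 \<sigma>2 \<sigma>3 \<sigma>4 :: "nat \<Rightarrow> nat"
  assume \<tau>: "\<tau>1 permutes {..<2}" "\<tau>2 permutes {..<2}"
    and \<sigma>: "\<sigma>1 permutes {..<n}" "\<sigma>2 permutes {..<n}" "\<sigma>3 permutes {..<n}" "\<sigma>4 permutes {..<n}"
  \<comment> \<open>Letter 0 is the coefficient carrying \<open>x\<close>, letter \<open>n\<close>
    the one carrying \<open>x'\<close>, and the letters in between carry the
    \<open>y\<^sub>i\<close>.\<close>
  define \<alpha> where "\<alpha> = restrict (\<lambda>i. if i = 0 then (\<sigma>1 0, \<sigma>2 0, \<tau>1 0, \<tau>2 0)
      else if i = n then (\<sigma>3 0, \<sigma>4 0, \<tau>1 1, \<tau>2 1) else (\<sigma>1 i, \<sigma>2 i, \<sigma>3 i, \<sigma>4 i)) {..<n + 1}"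
  have \<sigma>_less: "\<rho> i < length bs" if "\<rho> permutes {..<n}" "i < n" for \<rho> i
    using permutes_in_image[OF that(1), of i] that(2) n by simp
  have \<tau>_less: "\<rho> i < length bs" if "\<rho> permutes {..<2}" "i < 2" for \<rho> and i :: nat
    using permutes_in_image[OF that(1), of i] that(2) n by simp
  have "\<alpha> \<in> words (n + 1)"
    using n by (auto simp: words_def letters_def \<alpha>_def intro!: \<sigma>_less[OF \<sigma>(1)] \<sigma>_less[OF \<sigma>(2)]
        \<sigma>_less[OF \<sigma>(3)] \<sigma>_less[OF \<sigma>(4)] \<tau>_less[OF \<tau>(1)] \<tau>_less[OF \<tau>(2)])
  moreover have "(\<Prod>i<n + 1. pol_letter f (\<alpha> i)) = kern n (pol f) (((!) bs \<circ> \<tau>1) 0) (((!) bs \<circ> \<tau>1) 1)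
      (((!) bs \<circ> \<tau>2) 0) (((!) bs \<circ> \<tau>2) 1) ((!) bs \<circ> \<sigma>1) ((!) bs \<circ> \<sigma>2) ((!) bs \<circ> \<sigma>3) ((!) bs \<circ> \<sigma>4)" for f
  proof -
    have "{..<n + 1} = insert 0 (insert n {1..<n})" using n by auto
    then have "(\<Prod>i<n + 1. pol_letter f (\<alpha> i)) =
      pol_letter f (\<alpha> 0) * (pol_letter f (\<alpha> n) * (\<Prod>i\<in>{1..<n}. pol_letter f (\<alpha> i)))"
      using n by simp
    also have "(\<Prod>i\<in>{1..<n}. pol_letter f (\<alpha> i)) =
      (\<Prod>i\<in>{1..<n}. pol f (bs ! \<sigma>1 i) (bs ! \<sigma>2 i) (bs ! \<sigma>3 i) (bs ! \<sigma>4 i))"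
      by (rule prod.cong) (auto simp: \<alpha>_def pol_letter_def)
    finally show ?thesis using n by (simp add: kern_def \<alpha>_def pol_letter_def mult.assoc)
  qed
  ultimately show "(\<lambda>f. if f \<in> sym_dual (*s) 4 then kern n (pol f) (((!) bs \<circ> \<tau>1) 0) (((!) bs \<circ> \<tau>1) 1)
      (((!) bs \<circ> \<tau>2) 0) (((!) bs \<circ> \<tau>2) 1) ((!) bs \<circ> \<sigma>1) ((!) bs \<circ> \<sigma>2) ((!) bs \<circ> \<sigma>3) ((!) bs \<circ> \<sigma>4) else 0)
      \<in> cfun.span (mon (n + 1) ` words (n + 1))"
    by (intro cfun.span_base image_eqI[of _ _ \<alpha>]) (auto simp: mon_def[abs_def])
qed

end

section \<open>The secant variety and the Schur module\<close>

lemma linear_combinations_of_lines: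
  fixes r :: nat
  assumes "z \<in> cfun.span (\<Union>i<r. cfun.span {y i})"
  obtains c where "z = (\<Sum>i<r. cfun_scale (c i) (y i))"
proof -
  have "z \<in> cfun.span (y ` {..<r})"
  proof -
    have "(\<Union>i<r. cfun.span {y i}) \<subseteq> cfun.span (y ` {..<r})"
      by (intro UN_least cfun.span_mono) auto
    then show ?thesis using assms cfun.span_minimal[OF _ cfun.subspace_span] by blast
  qed
  then have "\<exists>c. z = (\<Sum>i<r. cfun_scale (c i) (y i))"
  proof (induction rule: cfun.span_induct_alt)
    case base
    have "0 = (\<Sum>i<r. cfun_scale 0 (y i))" by simp
    then show ?case by (rule exI[of _ "\<lambda>_. 0"])
  next
    case (step k x z)
    then obtain c j where c: "z = (\<Sum>i<r. cfun_scale (c i) (y i))" and j: "j < r" "x = y j" by auto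
    have "cfun_scale k x = (\<Sum>i<r. cfun_scale (if i = j then k else 0) (y i))"
      using j by (simp add: if_distrib[of "\<lambda>k. cfun_scale k _"] cong: if_cong)
    then have "cfun_scale k x + z = (\<Sum>i<r. cfun_scale ((if i = j then k else 0) + c i) (y i))"
      by (simp add: c cfun.scale_left_distrib sum.distrib)
    then show ?case by (rule exI[of _ "\<lambda>i. (if i = j then k else 0) + c i"])
  qed
  then show thesis using that by blast
qed

context complex_vector_space
begin

text \<open>The zero locus of \<open>F\<close> is Zariski closed, so it contains the closure as soon
  as it contains the spans of \<open>r\<close> points, and an element of such a span is again a sum
  of \<open>r\<close> products of linear forms.\<close>

lemma vanishes_on_secant_variety:
  assumes F: "F \<in> hom_polys cfun_scale (sym_dual (*s) 4) d"
    and 0: "\<And>w. (\<And>a. a < 4 * r \<Longrightarrow> lin (w a)) \<Longrightarrow> F (\<lambda>v. \<Sum>i<r. \<Prod>j<4. w (4 * i + j) v) = 0"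
  shows "vanishes_on F (secant_variety cfun_scale (sym_dual (*s) 4) r (chow_dual (*s) 4))"
proof -
  let ?A = "sym_dual (*s) 4"
  let ?Z = "{p \<in> proj cfun_scale ?A. \<forall>F'\<in>{F}. vanishes_on F' {p}}"
  have "zariski_closed cfun_scale ?A ?Z"
    unfolding zariski_closed_def using F by (intro exI[of _ "{F}"]) auto
  moreover have "(\<Union>p \<in> {p. \<forall>i<r. p i \<in> chow_dual (*s) 4}. proj cfun_scale (cfun.span (\<Union>i<r. p i))) \<subseteq> ?Z"
  proof
    fix q assume "q \<in> (\<Union>p \<in> {p. \<forall>i<r. p i \<in> chow_dual (*s) 4}. proj cfun_scale (cfun.span (\<Union>i<r. p i)))"
    then obtain p z where p: "\<And>i. i < r \<Longrightarrow> p i \<in> chow_dual (*s) 4"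
      and z: "z \<in> cfun.span (\<Union>i<r. p i)" "z \<noteq> 0" "q = cfun.span {z}"
      unfolding proj_def by blast
    have "\<exists>y w. p i = cfun.span {y} \<and> y \<in> ?A \<and> (\<forall>j<4::nat. lin (w j)) \<and> y = (\<lambda>v. \<Prod>j<4. w j v)"
      if i: "i < r" for i
      using p[OF i] unfolding chow_dual_def proj_def linear_iff_lin by blast
    then obtain y w where yw: "\<And>i. i < r \<Longrightarrow> p i = cfun.span {y i} \<and> y i \<in> ?A \<and>
        (\<forall>j<4::nat. lin (w i j)) \<and> y i = (\<lambda>v. \<Prod>j<4. w i j v)"
      by metis
    have span: "cfun.span (\<Union>i<r. p i) = cfun.span (\<Union>i<r. cfun.span {y i})"
      using yw by simp
    have A: "cfun.subspace ?A" by (rule subspace_hom_polys)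
    have "F x = 0" if x: "x \<in> cfun.span (\<Union>i<r. p i)" for x
    proof -
      obtain c where c: "x = (\<Sum>i<r. cfun_scale (c i) (y i))"
        using linear_combinations_of_lines[of x y r] x span by blast
      \<comment> \<open>The scalar \<open>c i\<close> is absorbed into the first factor of product
        \<open>i\<close>; the form with index \<open>4 * i + j\<close> is factor \<open>j\<close> of
        that product.\<close>
      define w' where "w' a v = (if a mod 4 = 0 then c (a div 4) else 1) * w (a div 4) (a mod 4) v" for a v
      have lin: "lin (w' a)" if "a < 4 * r" for a
      proof -
        have "a div 4 < r" using that by auto
        then show ?thesis unfolding w'_def[abs_def] using yw by (intro lin_cmult) auto
      qed
      have "(\<Prod>j<4. w' (4 * i + j) v) = c i * (\<Prod>j<4. w i j v)" for i v
      proof -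
        have "(\<Prod>j<4. w' (4 * i + j) v) = (\<Prod>j<4. (if j = 0 then c i else 1) * w i j v)"
          by (rule prod.cong) (auto simp: w'_def)
        then show ?thesis by (simp add: prod.distrib)
      qed
      then have "x = (\<lambda>v. \<Sum>i<r. \<Prod>j<4. w' (4 * i + j) v)"
        using yw by (simp add: fun_eq_iff c sum_fun_apply fun_scale_apply)
      then show ?thesis using 0[OF lin] by simp
    qed
    moreover have "cfun.span {z} \<subseteq> cfun.span (\<Union>i<r. p i)"
      using z(1) by (intro cfun.span_minimal) auto
    moreover have "z \<in> ?A"
    proof -
      have "p i \<subseteq> ?A" if "i < r" for i
      proof -
        have "cfun.span {y i} \<subseteq> ?A" using yw[OF that] by (intro cfun.span_minimal A) blast
        then show ?thesis using yw[OF that] by blast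
      qed
      then have "(\<Union>i<r. p i) \<subseteq> ?A" by blast
      then show ?thesis using z(1) cfun.span_minimal[OF _ A] by blast
    qed
    ultimately show "q \<in> ?Z" using z(2,3) unfolding proj_def vanishes_on_def by auto
  qed
  ultimately have "secant_variety cfun_scale ?A r (chow_dual (*s) 4) \<subseteq> ?Z"
    unfolding secant_variety_def by (intro hull_minimal)
  then show ?thesis by (auto simp: vanishes_on_def)
qed

lemma hw_vector_vanishes:
  assumes r: "r \<ge> 1" and w: "\<And>a. a < 4 * r \<Longrightarrow> lin (w a)"
  shows "hw_vector (4 * r) b (\<lambda>v. \<Sum>i<r. \<Prod>j<4. w (4 * i + j) v) = 0"
  using hw_form_eq_0[of r w, OF r w refl quadlin_pol] by (simp add: hw_vector_def)

lemma fun_act_twice_add: "g \<in> GL (*s) \<Longrightarrow> fun_act (fun_act g) (x + y) = fun_act (fun_act g) x + fun_act (fun_act g) y"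
  and fun_act_twice_scale: "g \<in> GL (*s) \<Longrightarrow> fun_act (fun_act g) (cfun_scale c x) = cfun_scale c (fun_act (fun_act g) x)"
  for x y :: "('v \<Rightarrow> complex) \<Rightarrow> complex"
  by (auto simp: fun_eq_iff fun_act_twice fun_scale_apply)

lemma is_GL_moduleI:
  assumes "cfun.subspace N" "\<And>g x. g \<in> GL (*s) \<Longrightarrow> x \<in> N \<Longrightarrow> fun_act (fun_act g) x \<in> N"
  shows "is_GL_module (*s) cfun_scale (\<lambda>g. fun_act (fun_act g)) (N :: (('v \<Rightarrow> complex) \<Rightarrow> complex) set)"
  unfolding is_GL_module_def
  using assms GL_id
  by (auto simp: fun_act_twice_add fun_act_twice_scale)
    (auto simp: fun_eq_iff fun_act_twice GL_comp comp_assoc)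

text \<open>A nonzero submodule of least dimension works: a basis of a nonzero submodule of it
  extends to one of the whole, and by minimality nothing is added.\<close>

lemma exists_irreducible_submodule:
  fixes M :: "(('v \<Rightarrow> complex) \<Rightarrow> complex) set"
  assumes M: "is_GL_module (*s) cfun_scale (\<lambda>g. fun_act (fun_act g)) M" "M \<noteq> {0}"
    and fin: "finite S" "M \<subseteq> cfun.span S"
  obtains N where "N \<subseteq> M" "irreducible_GL_module (*s) cfun_scale (\<lambda>g. fun_act (fun_act g)) N"
proof -
  let ?mod = "is_GL_module (*s) cfun_scale (\<lambda>g. fun_act (fun_act g)) :: (('v \<Rightarrow> complex) \<Rightarrow> complex) set \<Rightarrow> bool"
  define P where "P N \<longleftrightarrow> N \<subseteq> M \<and> ?mod N \<and> N \<noteq> {0}" for N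
  have "P M" using M by (simp add: P_def)
  then obtain N where N: "P N" and least: "\<And>N'. P N' \<Longrightarrow> cfun.dim N \<le> cfun.dim N'"
    using ex_has_least_nat[of P M cfun.dim] by blast
  have "N' = N" if N': "N' \<subseteq> N" "?mod N'" "N' \<noteq> {0}" for N'
  proof -
    have le: "cfun.dim N \<le> cfun.dim N'" using N N' by (intro least) (auto simp: P_def)
    obtain B' where B': "B' \<subseteq> N'" "cfun.independent B'" "N' \<subseteq> cfun.span B'"
      by (rule cfun.maximal_independent_subset)
    obtain B where B: "B' \<subseteq> B" "B \<subseteq> N" "cfun.independent B" "N \<subseteq> cfun.span B"
      using cfun.maximal_independent_subset_extend[of B' N] B' N' by blast
    have "finite B"
      using cfun.independent_span_bound[OF fin(1) B(3)] B(2) N fin(2) by (auto simp: P_def)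
    moreover have "card B \<le> card B'"
      using le cfun.basis_card_eq_dim[OF B(2,4,3)] cfun.basis_card_eq_dim[OF B'(1,3,2)] by simp
    ultimately have "B = B'" using B(1) by (metis card_seteq)
    moreover have "cfun.span B' \<subseteq> N'"
      using B'(1) N'(2) by (intro cfun.span_minimal) (auto simp: is_GL_module_def)
    ultimately show ?thesis using B(4) N'(1) by blast
  qed
  then have "irreducible_GL_module (*s) cfun_scale (\<lambda>g. fun_act (fun_act g)) N"
    using N unfolding irreducible_GL_module_def P_def by blast
  then show thesis using that N by (auto simp: P_def)
qed

end

lemma diff_swap: "a - c = d - b" if "a + b = c + d" for a b c d :: "'a::ab_group_add"
  using that by (simp add: algebra_simps)

section \<open>The highest weight vector and the module it generates\<close>

context complex_basis
begin

text \<open>On a monomial, \<open>\<phi>\<close> of the translate is a combination of the entries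
  \<open>word_mat d g \<beta> \<alpha>\<close> with the constants
  \<open>\<phi> (mon d \<beta>)\<close>, hence polynomial in \<open>g\<close>.\<close>

lemma polynomial_matrix_coefficients:
  assumes \<phi>: "Vector_Spaces.linear cfun_scale (*) \<phi>" and m: "m \<in> cfun.span (mon d ` words d)"
  shows "\<exists>F \<in> cfun.span (\<Union>d. hom_polys (fun_scale (*s)) {h. Vector_Spaces.linear (*s) (*s) h} d).
    \<forall>g\<in>GL (*s). \<phi> (fun_act (fun_act g) m) = F g"
  using m
proof (induction rule: cfun.span_induct_alt)
  interpret \<phi>: Vector_Spaces.linear cfun_scale "(*)" \<phi> by (rule \<phi>)
  {
    case base
    have "fun_act (fun_act g) 0 = (0 :: ('v \<Rightarrow> complex) \<Rightarrow> complex)" if "g \<in> GL (*s)" for g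
      using fun_act_twice_scale[OF that, of 0 0] by simp
    then have "\<forall>g\<in>GL (*s). \<phi> (fun_act (fun_act g) 0) = (0 :: ('v \<Rightarrow> 'v) \<Rightarrow> complex) g"
      by (simp add: \<phi>.zero)
    then show ?case by (rule bexI[OF _ cfun.span_zero])
  next
    case (step k x y)
    let ?S = "cfun.span (\<Union>d. hom_polys (fun_scale (*s)) {h. Vector_Spaces.linear (*s) (*s) h} d)"
    obtain F where F: "F \<in> ?S" "\<And>g. g \<in> GL (*s) \<Longrightarrow> \<phi> (fun_act (fun_act g) y) = F g"
      using step by blast
    obtain \<alpha> where x: "x = mon d \<alpha>" using step by blast
    define E where "E = (\<Sum>\<beta>\<in>words d. cfun_scale (\<phi> (mon d \<beta>))
      (\<lambda>h. if Vector_Spaces.linear (*s) (*s) h then word_mat d h \<beta> \<alpha> else 0))"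
    have "E \<in> ?S"
      unfolding E_def using word_mat_polynomial
      by (intro cfun.span_sum cfun.span_scale cfun.span_base) blast
    moreover have "\<phi> (fun_act (fun_act g) x) = E g" if "g \<in> GL (*s)" for g
      using that by (simp add: x fun_act_mon E_def \<phi>.sum \<phi>.scale sum_fun_apply fun_scale_apply GL_def mult.commute)
    ultimately have "cfun_scale k E + F \<in> ?S"
      "\<forall>g\<in>GL (*s). \<phi> (fun_act (fun_act g) (cfun_scale k x + y)) = (cfun_scale k E + F) g"
      using F by (auto intro!: cfun.span_add cfun.span_scale
          simp: fun_act_twice_add fun_act_twice_scale \<phi>.add \<phi>.scale fun_scale_apply)
    then show ?case by blast
  }
qed

text \<open>The four long brackets give the fourth power of the product of the first
  \<open>n\<close> diagonal entries, the two short ones the square of \<open>a 0 * a 1\<close>;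
  together this is the weight (6, 6, 4, ..., 4).\<close>

lemma hw_vector_borel:
  assumes n: "2 \<le> n" "n \<le> length bs" and g: "g \<in> borel_elems (*s) bs a"
  shows "fun_act (fun_act g) (hw_vector n ((!) bs)) =
    cfun_scale ((\<Prod>i<n. a i) ^ 4 * (a 0 * a 1) ^ 2) (hw_vector n ((!) bs))"
proof -
  have gGL: "g \<in> GL (*s)" and tri: "\<And>j. j < length bs \<Longrightarrow> g (bs ! j) - a j *s (bs ! j) \<in> span (set (take j bs))"
    using g by (auto simp: borel_elems_def)
  have "hw_form n (pol f) (g \<circ> (!) bs) (g \<circ> (!) bs) (g \<circ> (!) bs) (g \<circ> (!) bs) (g \<circ> (!) bs) (g \<circ> (!) bs) =
      (\<Prod>i<n. a i) ^ 4 * (a 0 * a 1) ^ 2 * hw_form n (pol f) ((!) bs) ((!) bs) ((!) bs) ((!) bs) ((!) bs) ((!) bs)"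
    if "f \<in> sym_dual (*s) 4" for f
  proof (rule hw_form_scale[OF quadlin_pol[OF that]])
    show "A (g \<circ> (!) bs) = (\<Prod>i<n. a i) * A ((!) bs)" if "alternating n A" for A
      by (rule alternating_triangular[OF that n(2) tri])
    show "A (g \<circ> (!) bs) = a 0 * a 1 * A ((!) bs)" if "alternating 2 A" for A
      using alternating_triangular[OF that _ tri] n by (simp add: eval_nat_numeral)
  qed (use n in simp)
  then show ?thesis
    unfolding fun_act_hw_vector[OF gGL] by (auto simp: fun_eq_iff hw_vector_def fun_scale_apply)
qed

lemma hw_vector_ne_0:
  assumes n: "2 \<le> n" "n \<le> length bs"
  shows "hw_vector n ((!) bs) \<noteq> 0"
proof -
  define L where "L k = (if k < n then coord k else (\<lambda>v. coord 0 v + coord 1 v))" for k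
  \<comment> \<open>The polarization of the fourth power of \<open>L k\<close> is 24 times the
    product of the four values; \<open>c\<close> removes this factor.\<close>
  define c :: complex where "c = 1 / 24"
  define f where "f v = (\<Sum>k\<le>n. c * L k v * L k v * L k v * L k v)" for v
  have L: "lin (L k)" for k by (auto simp: L_def lin_coord intro: lin_plus)
  have "f = (\<Sum>k\<le>n. (\<lambda>v. if v \<in> UNIV then \<Prod>j<(4 :: nat). ((if j = 0 then c else 1) * L k v) else 0))"
    by (simp add: fun_eq_iff f_def sum_fun_apply prod_lessThan_4)
  also have "\<dots> \<in> sym_dual (*s) 4"
    by (intro cfun.subspace_sum[OF subspace_hom_polys] prod_in_hom_polys)
      (simp add: linear_iff_lin lin_cmult L)
  finally have f: "f \<in> sym_dual (*s) 4" .
  have "pol f v1 v2 v3 v4 = (\<Sum>k\<le>n. L k v1 * L k v2 * L k v3 * L k v4)" for v1 v2 v3 v4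
  proof -
    have "pol (\<lambda>v. c * L k v * L k v * L k v * L k v) v1 v2 v3 v4 = L k v1 * L k v2 * L k v3 * L k v4" for k
      by (subst pol_prod[OF lin_cmult[OF L] L L L]) (simp add: c_def field_simps)
    then show ?thesis unfolding f_def[abs_def] pol_sum by simp
  qed
  then have "hw_form n (pol f) ((!) bs) ((!) bs) ((!) bs) ((!) bs) ((!) bs) ((!) bs) \<noteq> 0"
    using n by (intro hw_form_ne_0[of n L]) (auto simp: L_def coord_nth fun_eq_iff)
  then have "hw_vector n ((!) bs) f \<noteq> 0" using f by (simp add: hw_vector_def)
  then show ?thesis by auto
qed

lemma schur_module_in_ideal:
  assumes r: "r \<ge> 1" and n: "4 * r \<le> length bs"
  shows "\<exists>M. M \<subseteq> ideal_part cfun_scale (sym_dual (*s) 4) (4 * r + 1)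
                  (secant_variety cfun_scale (sym_dual (*s) 4) r (chow_dual (*s) 4)) \<and>
             is_schur_module (*s) cfun_scale (\<lambda>g. fun_act (fun_act g)) ([6, 6] @ replicate (4 * r - 2) 4) M"
proof -
  let ?n = "4 * r" and ?A = "sym_dual (*s) 4" and ?act = "\<lambda>g. fun_act (fun_act g)"
  let ?\<mu> = "[6, 6] @ replicate (4 * r - 2) 4 :: nat list"
  define H where "H = hw_vector ?n ((!) bs)"
  have n2: "2 \<le> ?n" using r by simp
  \<comment> \<open>A finite-dimensional invariant space that contains \<open>H\<close> and its
    orbit; complete reducibility is applied inside it.\<close>
  define P where "P = cfun.span (mon (?n + 1) ` words (?n + 1))"
  have P_hom: "P \<subseteq> hom_polys cfun_scale ?A (?n + 1)"
    unfolding P_def using mon_in_hom_polys by (intro cfun.span_minimal subspace_hom_polys) blast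
  have act_mon_span: "?act g x \<in> P" if g: "g \<in> GL (*s)" and "x \<in> P" for g x
    using that(2) unfolding P_def
  proof (induction rule: cfun.span_induct_alt)
    case base
    have "?act g 0 = (0 :: ('v \<Rightarrow> complex) \<Rightarrow> complex)"
      using fun_act_twice_scale[OF g, of 0 0] by simp
    then show ?case by (metis cfun.span_zero)
  next
    case (step k x y)
    then obtain \<alpha> where "x = mon (?n + 1) \<alpha>" by blast
    then have "?act g x \<in> cfun.span (mon (?n + 1) ` words (?n + 1))"
      by (simp only: fun_act_mon[OF g]) (intro cfun.span_sum cfun.span_scale cfun.span_base, blast)
    then show ?case using step(2)
      unfolding fun_act_twice_add[OF g] fun_act_twice_scale[OF g]
      by (intro cfun.span_add cfun.span_scale)
  qed
  have H: "H \<in> P" unfolding H_def P_def by (rule hw_vector_in_span[OF n2 n])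
  define M where "M = cfun.span ((\<lambda>g. ?act g H) ` GL (*s))"
  have act_comp: "?act g (?act h x) = ?act (g \<circ> h) x" if "g \<in> GL (*s)" "h \<in> GL (*s)"
    for g h and x :: "('v \<Rightarrow> complex) \<Rightarrow> complex"
    using that by (simp add: fun_eq_iff fun_act_twice GL_comp comp_assoc)
  have M_inv: "?act g x \<in> M" if g: "g \<in> GL (*s)" and "x \<in> M" for g x
    using that(2) unfolding M_def
  proof (induction rule: cfun.span_induct_alt)
    case base
    have "?act g 0 = (0 :: ('v \<Rightarrow> complex) \<Rightarrow> complex)"
      using fun_act_twice_scale[OF g, of 0 0] by simp
    then show ?case by (metis cfun.span_zero)
  next
    case (step k x y)
    then obtain h where h: "h \<in> GL (*s)" "x = ?act h H" by blast
    then have "?act g x \<in> cfun.span ((\<lambda>g. ?act g H) ` GL (*s))"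
      using act_comp[OF g h(1)] GL_comp[OF g h(1)] by (auto intro: cfun.span_base)
    then show ?case using step(2)
      unfolding fun_act_twice_add[OF g] fun_act_twice_scale[OF g]
      by (intro cfun.span_add cfun.span_scale)
  qed
  have M_mod: "is_GL_module (*s) cfun_scale ?act M"
    by (rule is_GL_moduleI[OF _ M_inv]) (auto simp: M_def cfun.subspace_span)
  have HM: "H \<in> M"
    unfolding M_def by (rule cfun.span_base, rule image_eqI[of _ _ id])
      (use GL_id in \<open>auto simp: fun_eq_iff fun_act_twice\<close>)
  have "M \<noteq> {0}" using HM hw_vector_ne_0[OF n2 n] by (auto simp: H_def)
  have MP: "M \<subseteq> P"
    unfolding M_def using act_mon_span H
    by (intro cfun.span_minimal) (auto simp: P_def cfun.subspace_span)
  obtain N where N: "N \<subseteq> M" and irr: "irreducible_GL_module (*s) cfun_scale ?act N"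
    using exists_irreducible_submodule[OF M_mod \<open>M \<noteq> {0}\<close>, of "mon (?n + 1) ` words (?n + 1)"]
      finite_words MP by (auto simp: P_def)
  have N_mod: "is_GL_module (*s) cfun_scale ?act N" and N0: "N \<noteq> {0}"
    using irr by (auto simp: irreducible_GL_module_def)
  then have N_sub: "cfun.subspace N" and N_inv: "\<And>g x. g \<in> GL (*s) \<Longrightarrow> x \<in> N \<Longrightarrow> ?act g x \<in> N"
    by (auto simp: is_GL_module_def)
  obtain C where C: "cfun.subspace C" "\<And>g x. g \<in> GL (*s) \<Longrightarrow> x \<in> C \<Longrightarrow> ?act g x \<in> C"
    "\<And>x. x \<in> N \<Longrightarrow> x \<in> C \<Longrightarrow> x = 0" "\<And>x. x \<in> P \<Longrightarrow> \<exists>y\<in>N. \<exists>z\<in>C. x = y + z"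
    unfolding P_def
  proof (rule invariant_complement[of "words (?n + 1)" "GL (*s)" ?act "mon (?n + 1)" "word_mat (?n + 1)" N])
    show "\<exists>h\<in>GL (*s). \<forall>\<alpha>\<in>words (?n + 1). \<forall>\<beta>\<in>words (?n + 1).
        word_mat (?n + 1) h \<beta> \<alpha> = cnj (word_mat (?n + 1) g \<alpha> \<beta>)" if "g \<in> GL (*s)" for g
      using adjoint_GL[OF that] word_mat_adjoint by blast
  qed (use finite_words N_sub N_inv in \<open>auto simp: fun_act_twice_add fun_act_twice_scale fun_act_mon\<close>)
  obtain m z where mz: "m \<in> N" "z \<in> C" "H = m + z" using C(4) H by blast
  have "m \<noteq> 0"
  proof
    assume "m = 0"
    then have "H \<in> C" using mz by simp
    \<comment> \<open>\<open>C\<close> is invariant, so with \<open>H\<close> it would contain all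
      of \<open>M\<close>, whereas \<open>N\<close> is a nonzero submodule of \<open>M\<close> that
      meets \<open>C\<close> only in 0.\<close>
    then have "M \<subseteq> C" unfolding M_def using C(1,2) by (intro cfun.span_minimal) auto
    then have "N \<subseteq> {0}" using N C(3) by blast
    then show False using N0 cfun.subspace_0[OF N_sub] by blast
  qed
  moreover have "?act g m = cfun_scale (\<Prod>i<length ?\<mu>. a i ^ (?\<mu> ! i)) m"
    if g: "g \<in> borel_elems (*s) bs a" for a g
  proof -
    have gGL: "g \<in> GL (*s)" using g by (simp add: borel_elems_def)
    let ?\<chi> = "(\<Prod>i<?n. a i) ^ 4 * (a 0 * a 1) ^ 2"
    \<comment> \<open>The eigenvector equation for \<open>H\<close>, split into its components:
      since \<open>N\<close> and \<open>C\<close> meet only in 0, it holds for \<open>m\<close>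
      separately.\<close>
    have "?act g m + ?act g z = cfun_scale ?\<chi> m + cfun_scale ?\<chi> z"
      using hw_vector_borel[OF n2 n g] mz(3) by (simp add: H_def[symmetric] fun_act_twice_add[OF gGL] cfun.scale_right_distrib)
    then have "?act g m - cfun_scale ?\<chi> m = cfun_scale ?\<chi> z - ?act g z"
      by (rule diff_swap)
    moreover have "?act g m - cfun_scale ?\<chi> m \<in> N"
      using N_sub N_inv[OF gGL] mz(1) by (intro cfun.subspace_diff cfun.subspace_scale)
    moreover have "cfun_scale ?\<chi> z - ?act g z \<in> C"
      using C(1,2) gGL mz(2) by (intro cfun.subspace_diff cfun.subspace_scale)
    ultimately have "?act g m - cfun_scale ?\<chi> m = 0" using C(3) by metis
    then have "?act g m = cfun_scale ?\<chi> m" by (simp only: right_minus_eq)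
    also have "?\<chi> = (\<Prod>i<length ?\<mu>. a i ^ (?\<mu> ! i))"
    proof -
      have "length ?\<mu> = ?n" using n2 by simp
      moreover have "{..<?n} = insert 0 (insert 1 {2..<?n})" using n2 by auto
      moreover have "(\<Prod>i\<in>{2..<?n}. a i ^ (?\<mu> ! i)) = (\<Prod>i\<in>{2..<?n}. a i ^ 4)"
        by (rule prod.cong) (auto simp: nth_Cons' )
      ultimately show ?thesis
        by (simp add: prod_power_distrib power_mult_distrib mult_ac flip: power_add)
    qed
    finally show ?thesis .
  qed
  ultimately have hwv: "highest_weight_vector (*s) cfun_scale ?act bs ?\<mu> m"
    by (simp only: highest_weight_vector_def) blast
  have poly: "polynomial_GL_module (*s) cfun_scale ?act N"
    unfolding polynomial_GL_module_def
  proof (intro conjI allI impI N_mod, elim conjE)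
    fix \<phi> :: "(('v \<Rightarrow> complex) \<Rightarrow> complex) \<Rightarrow> complex" and m
    assume "Vector_Spaces.linear cfun_scale (*) \<phi>" "m \<in> N"
    then show "\<exists>F\<in>cfun.span (\<Union> (range (hom_polys (fun_scale (*s)) (Collect (Vector_Spaces.linear (*s) (*s)))))).
        \<forall>g\<in>GL (*s). \<phi> (?act g m) = F g"
      using polynomial_matrix_coefficients[of \<phi> m "?n + 1"] N MP by (auto simp: P_def)
  qed
  have "is_schur_module (*s) cfun_scale ?act ?\<mu> N"
    unfolding is_schur_module_def
  proof (intro conjI irr poly)
    show "sorted_wrt (\<ge>) ?\<mu>" by (auto simp: sorted_wrt_append sorted_wrt_iff_nth_less nth_Cons' less_Suc_eq_0_disj)
    show "\<exists>bs. ordered_basis (*s) bs \<and> length ?\<mu> \<le> length bs \<and>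
        (\<exists>m\<in>N. highest_weight_vector (*s) cfun_scale ?act bs ?\<mu> m)"
      using bs n n2 hwv mz(1) by (intro exI[of _ bs]) auto
  qed
  moreover have "N \<subseteq> ideal_part cfun_scale ?A (?n + 1) (secant_variety cfun_scale ?A r (chow_dual (*s) 4))"
  proof
    fix F assume "F \<in> N"
    then have FM: "F \<in> M" using N by blast
    then have F: "F \<in> hom_polys cfun_scale ?A (?n + 1)" using MP P_hom by blast
    \<comment> \<open>\<open>M\<close> is spanned by the orbit of \<open>H\<close>, and each
      translate is \<open>hw_vector\<close> for another tuple, to which
      \<open>hw_vector_vanishes\<close> applies.\<close>
    have "F (\<lambda>v. \<Sum>i<r. \<Prod>j<4. w (4 * i + j) v) = 0" if w: "\<And>a. a < ?n \<Longrightarrow> lin (w a)" for w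
      using FM unfolding M_def
    proof (induction rule: cfun.span_induct_alt)
      case (step k x y)
      then obtain g where "g \<in> GL (*s)" "x = ?act g H" by blast
      then show ?case using step(2) hw_vector_vanishes[of r w, OF r w] by (simp add: H_def fun_act_hw_vector fun_scale_apply)
    qed simp
    then show "F \<in> ideal_part cfun_scale ?A (?n + 1) (secant_variety cfun_scale ?A r (chow_dual (*s) 4))"
      unfolding ideal_part_def using F vanishes_on_secant_variety[OF F, of r] by blast
  qed
  ultimately show ?thesis by blast
qed

end

theorem theorem1p4:
  fixes scale :: "complex \<Rightarrow> 'v::ab_group_add \<Rightarrow> 'v" and Basis :: "'v set" and r :: nat
  assumes "finite_dimensional_vector_space scale Basis"
    and "r \<ge> 1"
    and "vector_space.dim scale (UNIV :: 'v set) \<ge> 4 * r"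
  shows "\<exists>M. M \<subseteq> ideal_part cfun_scale (sym_dual scale 4) (4 * r + 1)
                  (secant_variety cfun_scale (sym_dual scale 4) r (chow_dual scale 4)) \<and>
             is_schur_module scale cfun_scale (\<lambda>g. fun_act (fun_act g))
               ([6, 6] @ replicate (4 * r - 2) 4) M"
proof -
  interpret finite_dimensional_vector_space scale Basis by (rule assms(1))
  obtain xs where xs: "set xs = Basis" "distinct xs"
    using finite_distinct_list[OF finite_Basis] by blast
  interpret complex_basis scale xs
    by unfold_locales (simp add: ordered_basis_def xs independent_Basis span_Basis)
  have "4 * r \<le> length xs"
    using assms(3) xs distinct_card[OF xs(2)] by simp
  then show ?thesis by (rule schur_module_in_ideal[OF assms(2)])
qed

end
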